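(* Let $f,g\in\mathcal G$ be such that $f(x)\ge g(x)$ for all $x\in[0,1]$. Then $I_f\supset I_g$.
   Context: **The classes $\mathcal S$ and $\mathcal G$.** $\mathcal S$ is the set of all convex (meaning concave down) maps $f:[0,1]\to[0,1]$ with a unique turning point $c_f$, which is a maximum, such that $f|_{[0,c_f]}$ and $f|_{[c_f,1]}$ are $C^1$, $f(c_f)>c_f$ and $f(0)=f(1)=0$. $\mathcal G\subset\mathcal S$ is the set of all $g\in\mathcal S$ that are polynomial maps of $[0,1]$ into itself of degree no more than $3$. **Over-rotation interval.** For a continuous map $f$ of a compact interval into itself put $\chi(x)=1/2$ if $(f(x)-x)(f^2(x)-f(x))\le 0$ and $\chi(x)=0$ otherwise. For a non-fixed periodic point $y$ of (minimal) period $n$ let $l(y)=\sum_{i=0}^{n-1}\chi(f^i(y))$ (an integer); the over-rotation number of $y$ is $l(y)/n$. The over-rotation interval $I_f$ is the closure of the set of over-rotation numbers of all non-fixed periodic points of $f$; it is known that if $f$ has a non-fixed periodic point then $I_f=[\rho_f,1/2]$ for some $0\le\rho_f\le 1/2$. (Standing assumption: maps considered have non-fixed periodic points; otherwise $I_f=\emptyset$.) *)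

theory Defs
  imports "HOL-Analysis.Analysis" "HOL-Computational_Algebra.Polynomial"
begin

(* A map of [0,1] into itself is represented by a function on the reals;
   only its values on [0,1] are ever used. *)

(* C^1 on the compact interval [a,b], with one-sided derivatives at the endpoints.
   (C1_differentiable_on would ask for two-sided ones, which is wrong at a kink.) *)
definition C1_on_interval :: "real \<Rightarrow> real \<Rightarrow> (real \<Rightarrow> real) \<Rightarrow> bool" where
  "C1_on_interval a b f \<longleftrightarrow>
     (\<exists>f'. (\<forall>x\<in>{a..b}. (f has_real_derivative f' x) (at x within {a..b})) \<and>
           continuous_on {a..b} f')"

definition turning_point :: "(real \<Rightarrow> real) \<Rightarrow> real \<Rightarrow> bool" where
  "turning_point f c \<longleftrightarrow> c \<in> {0<..<1} \<and>
     (\<forall>e>0. \<not> mono_on ({c - e<..<c + e} \<inter> {0..1}) f \<and>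
            \<not> antimono_on ({c - e<..<c + e} \<inter> {0..1}) f)"

definition class_S :: "(real \<Rightarrow> real) set" where
  "class_S = {f. f ` {0..1} \<subseteq> {0..1} \<and> concave_on {0..1} f \<and>
     (\<exists>c. turning_point f c \<and> (\<forall>c'. turning_point f c' \<longrightarrow> c' = c) \<and>
          (\<forall>x\<in>{0..1}. f x \<le> f c) \<and>
          C1_on_interval 0 c f \<and> C1_on_interval c 1 f \<and> f c > c) \<and>
     f 0 = 0 \<and> f 1 = 0}"

definition class_G :: "(real \<Rightarrow> real) set" where
  "class_G = {g \<in> class_S. \<exists>p::real poly. degree p \<le> 3 \<and> (\<forall>x\<in>{0..1}. g x = poly p x)}"

definition is_periodic :: "('a \<Rightarrow> 'a) \<Rightarrow> 'a \<Rightarrow> bool" where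
  "is_periodic f y \<longleftrightarrow> (\<exists>n>0. (f ^^ n) y = y)"

(* the minimal period; meaningful only for periodic points *)
definition period :: "('a \<Rightarrow> 'a) \<Rightarrow> 'a \<Rightarrow> nat" where
  "period f y = (LEAST n. n > 0 \<and> (f ^^ n) y = y)"

definition nonfixed_periodic_points :: "real set \<Rightarrow> (real \<Rightarrow> real) \<Rightarrow> real set" where
  "nonfixed_periodic_points J f = {y \<in> J. is_periodic f y \<and> f y \<noteq> y}"

definition over_rot_chi :: "(real \<Rightarrow> real) \<Rightarrow> real \<Rightarrow> real" where
  "over_rot_chi f x = (if (f x - x) * (f (f x) - f x) \<le> 0 then 1/2 else 0)"

definition over_rotation_number :: "(real \<Rightarrow> real) \<Rightarrow> real \<Rightarrow> real" where
  "over_rotation_number f y =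
     (\<Sum>i<period f y. over_rot_chi f ((f ^^ i) y)) / real (period f y)"

(* J is the compact interval that f maps into itself *)
definition over_rotation_interval :: "real set \<Rightarrow> (real \<Rightarrow> real) \<Rightarrow> real set" where
  "over_rotation_interval J f =
     closure (over_rotation_number f ` nonfixed_periodic_points J f)"

end

theory Submission
  imports Defs
begin

text \<open>
  A map of the class has the form x (1 - x) (A (1 - x) + B x), with A \<le> 2 B and B \<le> 2 A by
  concavity. Let a be its fixed point to the right of the turning point. Points of (0, a) move to
  the right and points of (a, 1] are sent below a, so a non-fixed periodic orbit changes its
  direction exactly when it enters or leaves (a, 1]: its over-rotation number is the frequency of
  its visits to (a, 1] (\<open>over_rotation_number_eq\<close>). The number 1/2 belongs to the orbits that
  alternate between the two sides of a, and every map with a non-fixed periodic point has such an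
  orbit, of period two (\<open>half_attained\<close>).

  Let g \<le> f. It is shown that every over-rotation number of g is one of f, before closures are
  taken (\<open>cubic_over_rotation_subset\<close>). Only a periodic orbit of g with two consecutive points on
  the left of its fixed point needs work. For it a periodic orbit of f is found that visits the
  two sides in the same order (\<open>transfer_orbit\<close>). To the right of a the orbit of g is thrown to the
  left, then it climbs back, and so on; a point is followed under f from each moment at which the
  orbit of g is about to jump over its fixed point. As long as f stays below g until the next
  such moment, the segments between these points and the fixed point of f (or its left preimage)
  cover each other under f in a closed loop, and a closed loop of coverings contains a periodic
  orbit (\<open>segment_loop_shadowed\<close>).

  That f stays below g (\<open>orbit_comparison\<close>) is the heart of the matter, because f climbs faster
  than g. The compensation comes from the jump: f overshoots the fixed point more than g does,
  so it is thrown further to the left. The gain per climbing step is controlled by a barrier: if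
  f lags behind a point y of the climbing orbit of g by at least K (a - y), this remains so after
  one step, where K is fixed by f - g and the slope of g at the left preimage of a
  (\<open>climb_step\<close>). The jump produces this lag (\<open>two_steps\<close>) provided g is steep at a. Steepness,
  |g'(a)| \<ge> 8/5, follows from the existence of two consecutive points on the left
  (\<open>steep_ge\<close>): a flat fixed point would trap the orbit near itself. As f - g is a nonnegative
  combination of x (1 - x)^2 and x^2 (1 - x), the inequality for the jump has to be proved only
  for these two bumps (\<open>bump0_margin\<close>, \<open>bump1_margin\<close>), where it holds with room to spare.
\<close>

section \<open>Concave cubics vanishing at 0 and 1\<close>

definition cub :: "real \<Rightarrow> real \<Rightarrow> real \<Rightarrow> real" where
  "cub A B x = x * (1 - x) * (A * (1 - x) + B * x)"

definition dcub :: "real \<Rightarrow> real \<Rightarrow> real \<Rightarrow> real" where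
  "dcub A B x = A * (1 - x) * (1 - 3 * x) + B * x * (2 - 3 * x)"

lemma cub_add: "cub (A + A') (B + B') x = cub A B x + cub A' B' x"
  by (simp add: cub_def algebra_simps)

lemma cub_split: "cub A B x = A * (x * (1 - x)\<^sup>2) + B * (x\<^sup>2 * (1 - x))"
  by (simp add: cub_def power2_eq_square algebra_simps)

lemma cub_0 [simp]: "cub A B 0 = 0" and cub_1 [simp]: "cub A B 1 = 0"
  by (simp_all add: cub_def)

lemma cub_nonneg: "0 \<le> A \<Longrightarrow> 0 \<le> B \<Longrightarrow> x \<in> {0..1} \<Longrightarrow> 0 \<le> cub A B x"
  by (simp add: cub_def)

lemma continuous_on_cub [continuous_intros]: "continuous_on S (cub A B)"
  unfolding cub_def by (intro continuous_intros)

text \<open>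
  The last bracket, with s = u + 2 y, governs everything below: at s = 3 x it is minus one half
  of the second derivative at x, so that concavity on [0, 1] is its nonnegativity for s in [0, 3].
\<close>

lemma cub_taylor:
  "cub A B u = cub A B y + dcub A B y * (u - y)
     - (u - y)\<^sup>2 * (2 * A - B + (B - A) * (u + 2 * y))"
  unfolding cub_def dcub_def by algebra

lemma bracket_nonneg:
  fixes A B s :: real
  assumes "A \<le> 2 * B" "B \<le> 2 * A" "0 \<le> s" "s \<le> 3"
  shows "0 \<le> 2 * A - B + (B - A) * s"
proof -
  have eq: "2 * A - B + (B - A) * s = ((3 - s) * (2 * A - B) + s * (2 * B - A)) / 3"
    by (simp add: field_simps)
  have "0 \<le> (3 - s) * (2 * A - B) + s * (2 * B - A)"
    using assms by (intro add_nonneg_nonneg mult_nonneg_nonneg) auto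
  then show ?thesis unfolding eq by simp
qed

lemma bracket_pos:
  fixes A B s :: real
  assumes "0 < A" "A \<le> 2 * B" "B \<le> 2 * A" "0 < s" "s < 3"
  shows "0 < 2 * A - B + (B - A) * s"
proof -
  have eq: "2 * A - B + (B - A) * s = ((3 - s) * (2 * A - B) + s * (2 * B - A)) / 3"
    by (simp add: field_simps)
  have "0 < (3 - s) * (2 * A - B) + s * (2 * B - A)"
  proof (cases "2 * A - B = 0")
    case True
    then have "0 < s * (2 * B - A)" using assms by (intro mult_pos_pos) auto
    then show ?thesis using True by simp
  next
    case False
    then have "0 < (3 - s) * (2 * A - B)" using assms by (intro mult_pos_pos) auto
    moreover have "0 \<le> s * (2 * B - A)" using assms by simp
    ultimately show ?thesis by linarith
  qed
  then show ?thesis unfolding eq by simp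
qed

text \<open>
  Concavity, in the form in which it is used: the graph lies below its tangents.
\<close>

lemma cub_le_tangent:
  assumes "A \<le> 2 * B" "B \<le> 2 * A" "u \<in> {0..1}" "y \<in> {0..1}"
  shows "cub A B u \<le> cub A B y + dcub A B y * (u - y)"
proof -
  have "0 \<le> 2 * A - B + (B - A) * (u + 2 * y)"
    using assms by (intro bracket_nonneg) auto
  then show ?thesis using cub_taylor[of A B u y] by (simp add: mult_nonneg_nonneg)
qed

lemma dcub_antimono:
  assumes "A \<le> 2 * B" "B \<le> 2 * A" "0 \<le> x" "x \<le> y" "y \<le> 1"
  shows "dcub A B y \<le> dcub A B x"
proof -
  have eq: "dcub A B x - dcub A B y = (y - x) * (2 * (2 * A - B + (B - A) * (3 / 2 * (x + y))))"
    by (simp add: dcub_def field_simps)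
  have "0 \<le> 2 * A - B + (B - A) * (3 / 2 * (x + y))"
    using assms by (intro bracket_nonneg) auto
  then have "0 \<le> dcub A B x - dcub A B y"
    unfolding eq using assms by (intro mult_nonneg_nonneg) auto
  then show ?thesis by simp
qed

text \<open>The difference quotient of the cubic between x and a, with the removable singularity at a
  filled by the derivative.\<close>

definition chord :: "real \<Rightarrow> real \<Rightarrow> real \<Rightarrow> real \<Rightarrow> real" where
  "chord A B a x = A + (B - 2 * A) * (x + a) + (A - B) * (x\<^sup>2 + x * a + a\<^sup>2)"

lemma cub_chord: "cub A B x - cub A B a = (x - a) * chord A B a x"
  unfolding cub_def chord_def by algebra

lemma chord_diff:
  "chord A B a x - chord A B a y = (y - x) * (2 * A - B + (B - A) * (x + y + a))"
  unfolding chord_def by algebra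

lemma chord_self: "chord A B a a = dcub A B a"
  unfolding chord_def dcub_def by algebra

text \<open>
  What is used of a map of the class. The bound on A + B says that the value at 1/2 is at most 1.
\<close>

locale concave_cubic =
  fixes A B a :: real
  assumes A_pos: "0 < A" and AB: "A \<le> 2 * B" and BA: "B \<le> 2 * A"
    and a_pos: "0 < a" and a_less: "a < 1" and fix_a: "cub A B a = a"
    and descending: "dcub A B a < 0" and AB8: "A + B \<le> 8"
begin

abbreviation g where "g \<equiv> cub A B"
abbreviation dg where "dg \<equiv> dcub A B"

definition steep where "steep = - dg a"

lemma steep_pos: "0 < steep" using descending by (simp add: steep_def)

lemma B_pos: "0 < B" using A_pos AB by linarith

lemma tangent: "u \<in> {0..1} \<Longrightarrow> y \<in> {0..1} \<Longrightarrow> g u \<le> g y + dg y * (u - y)"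
  using cub_le_tangent[OF AB BA] by blast

lemma chord_strict:
  assumes "0 \<le> x" "x < y" "y \<le> 1"
  shows "chord A B a y < chord A B a x"
proof -
  have "0 < 2 * A - B + (B - A) * (x + y + a)"
    using assms a_pos a_less A_pos AB BA by (intro bracket_pos) auto
  then have "0 < (y - x) * (2 * A - B + (B - A) * (x + y + a))"
    using assms by simp
  then show ?thesis using chord_diff[of A B a x y] by linarith
qed

lemma g_eq: "g x - a = (x - a) * chord A B a x"
  using cub_chord[of A B x a] fix_a by simp

lemma g_minus_id: "g x - x = x * (a - x) * (2 * A - B + (B - A) * (x + a))"
proof -
  have one: "(1 - a) * (A * (1 - a) + B * a) = 1"
    using fix_a a_pos unfolding cub_def mult.assoc by simp
  have "g x - x = x * ((1 - x) * (A * (1 - x) + B * x) - (1 - a) * (A * (1 - a) + B * a))"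
    unfolding one by (simp add: cub_def algebra_simps)
  also have "\<dots> = x * (a - x) * (2 * A - B + (B - A) * (x + a))"
    by algebra
  finally show ?thesis .
qed

lemma bracket2:
  assumes "0 \<le> x" "x \<le> 1"
  shows "0 < 2 * A - B + (B - A) * (x + a)"
  using assms a_pos a_less A_pos AB BA by (intro bracket_pos) auto

lemma above_diag: "0 < x \<Longrightarrow> x < a \<Longrightarrow> x < g x"
  using g_minus_id[of x] mult_pos_pos[OF mult_pos_pos[of x "a - x"] bracket2[of x]] a_less
  by auto

lemma below_diag: "a < x \<Longrightarrow> x \<le> 1 \<Longrightarrow> g x < x"
  using g_minus_id[of x] mult_neg_pos[OF mult_pos_neg[of x "a - x"] bracket2[of x]] a_pos
  by auto

text \<open>
  The left preimage of a is the zero of the difference quotient, which is 1 at 0 and negative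
  at a; by \<open>chord_strict\<close> there is only one.
\<close>

lemma ex_pre: "\<exists>b. 0 < b \<and> b < a \<and> chord A B a b = 0"
proof -
  have c0: "chord A B a 0 = 1"
    using g_eq[of 0] a_pos by simp
  have ca: "chord A B a a < 0" using descending by (simp add: chord_self)
  have "continuous_on {0..a} (chord A B a)"
    unfolding chord_def by (intro continuous_intros)
  then obtain b where b: "0 \<le> b" "b \<le> a" "chord A B a b = 0"
    using IVT2'[of "chord A B a" a 0 0] c0 ca a_pos by auto
  then have "b \<noteq> 0" "b \<noteq> a" using c0 ca by auto
  then have "0 < b \<and> b < a \<and> chord A B a b = 0" using b by simp
  then show ?thesis by blast
qed

definition pre where "pre = (SOME b. 0 < b \<and> b < a \<and> chord A B a b = 0)"

lemma pre: "0 < pre" "pre < a" "chord A B a pre = 0"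
  using someI_ex[OF ex_pre] unfolding pre_def by auto

lemma g_pre: "g pre = a" using g_eq[of pre] pre by simp

lemma below_pre: "0 \<le> x \<Longrightarrow> x < pre \<Longrightarrow> g x < a"
  using g_eq[of x] chord_strict[of x pre] pre a_less
    mult_neg_pos[of "x - a" "chord A B a x"] by auto

lemma above_pre: "pre < x \<Longrightarrow> x < a \<Longrightarrow> a < g x"
  using g_eq[of x] chord_strict[of pre x] pre a_less
    mult_neg_neg[of "x - a" "chord A B a x"] by auto

lemma right_below: "a < x \<Longrightarrow> x \<le> 1 \<Longrightarrow> g x < a"
  using g_eq[of x] chord_strict[of pre x] pre a_less
    mult_pos_neg[of "x - a" "chord A B a x"] by auto

lemma dg_pre_nonneg: "y \<le> pre \<Longrightarrow> 0 \<le> y \<Longrightarrow> 0 \<le> dg y"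
proof -
  assume y: "y \<le> pre" "0 \<le> y"
  have "a \<le> a + dg pre * (a - pre)"
    using tangent[of a pre] g_pre fix_a pre a_less by auto
  then have "0 \<le> dg pre * (a - pre)" by simp
  then have "0 \<le> dg pre" using pre by (simp add: zero_le_mult_iff)
  then show ?thesis using dcub_antimono[OF AB BA, of y pre] y pre a_less by linarith
qed

text \<open>
  A point that jumps over the fixed point can be replaced by one with the same image on the
  descending branch, where the estimates hold.
\<close>

lemma reflect:
  assumes "0 < x" "x < a" "a < g x"
  shows "\<exists>x'\<ge>x. x' < a \<and> g x' = g x \<and> dg x' \<le> 0"
proof (cases "dg x \<le> 0")
  case True then show ?thesis using assms by blast
next
  case False
  have "continuous_on {x..a} dg" unfolding dcub_def by (intro continuous_intros)
  then obtain c where c: "x \<le> c" "c \<le> a" "dg c = 0"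
    using IVT2'[of dg a 0 x] False descending assms by auto
  have "g x \<le> g c" using tangent[of x c] c assms a_less by auto
  moreover have "continuous_on {c..a} g" by (intro continuous_intros)
  ultimately obtain x' where x': "c \<le> x'" "x' \<le> a" "g x' = g x"
    using IVT2'[of g a "g x" c] assms fix_a c by auto
  then have "x' \<noteq> a" using assms fix_a by auto
  moreover have "dg x' \<le> 0"
    using dcub_antimono[OF AB BA, of c x'] c x' a_less assms by auto
  ultimately show ?thesis using x' c by (intro exI[of _ x']) auto
qed

end


section \<open>Estimates at a steep fixed point\<close>

text \<open>
  This is the steepness bound in coordinates in which the fixed point is 0, its left preimage is
  -1 and distances are measured in units of their difference. The point at distance k left of the
  fixed point is sent to distance h on its right, and this one to distance h (1 + h) (l - Q h) on
  the left, where l is the steepness and Q the coefficient of the cubic term. For Q = 0 the bound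
  would be about 1.68; the weaker 8/5 holds for all Q.
\<close>

lemma renormalised_steepness_bound:
  fixes k l Q h :: real
  assumes k: "0 \<le> k" "k \<le> 1" and l: "0 < l" "0 \<le> l + 2 * Q"
    and h: "h = k * (1 - k) * (l + Q * k)" and ret: "1 \<le> h * (1 + h) * (l - Q * h)"
  shows "8 / 5 \<le> l"
proof (rule ccontr)
  assume "\<not> 8 / 5 \<le> l"
  then have l2: "l < 8 / 5" by simp
  have kk: "0 \<le> k * (1 - k)" using k by simp
  have "0 \<le> (k - 1/2)\<^sup>2" by simp
  then have kk4: "k * (1 - k) \<le> 1/4" by (simp add: power2_eq_square algebra_simps)
  have lk: "0 \<le> l + Q * k"
  proof (cases "Q \<ge> 0")
    case True then show ?thesis using l k by simp
  next
    case False
    then have "Q * 1 \<le> Q * k" using k by (intro mult_left_mono_neg) auto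
    then show ?thesis using l by linarith
  qed
  have h0: "0 \<le> h" unfolding h using kk lk by (rule mult_nonneg_nonneg)
  have hl: "k * (1 - k) * l \<le> 2/5"
    using mult_mono[of "k * (1 - k)" "1/4" l "8/5"] kk4 l2 l by simp
  show False
  proof (cases "Q \<ge> 0")
    case True
    have "0 \<le> (k - 2/3)\<^sup>2 * (k + 1/3)" using k by simp
    then have k3: "k\<^sup>2 * (1 - k) \<le> 4/27"
      by (simp add: power2_eq_square field_simps)
    have "h = k * (1 - k) * l + Q * (k\<^sup>2 * (1 - k))"
      unfolding h by (simp add: power2_eq_square algebra_simps)
    also have "\<dots> \<le> 2/5 + Q * (4/27)"
      using hl mult_left_mono[OF k3 True] by linarith
    finally have hQ: "h \<le> 2/5 + Q * (4/27)" .
    have hh: "0 \<le> h * (1 + h)" using h0 by simp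
    show False
    proof (cases "h \<le> 2/5")
      case True
      have "h * (1 + h) \<le> 2/5 * (7/5)" using True h0 by (intro mult_mono) auto
      moreover have "l - Q * h \<le> 8/5" using l2 mult_nonneg_nonneg[OF \<open>Q \<ge> 0\<close> h0] by linarith
      ultimately have "h * (1 + h) * (l - Q * h) \<le> 14/25 * (8/5)"
        using hh by (intro order_trans[OF mult_left_mono mult_right_mono]) auto
      then show False using ret by simp
    next
      case False
      have "(27/4) * (h - 2/5) * h \<le> Q * h"
        using hQ h0 by (intro mult_right_mono) auto
      then have "l - Q * h \<le> 8/5 - (27/4) * (h - 2/5) * h" using l2 by linarith
      then have "h * (1 + h) * (l - Q * h) \<le> h * (1 + h) * (8/5 - (27/4) * (h - 2/5) * h)"
        using hh by (rule mult_left_mono)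
      \<comment> \<open>The square is centred at the near-maximum of the quartic, about h = 0.48; completing the
            remaining quadratic leaves a positive constant.\<close>
      moreover have "1 - h * (1 + h) * (8/5 - (27/4) * (h - 2/5) * h)
        = 27/4 * (h\<^sup>2 + 3/10 * h - 3/8)\<^sup>2 + 31/200 * (h - 65/248)\<^sup>2
          + (13/256 - 31/200 * (65/248)\<^sup>2)"
        by (simp add: power2_eq_square field_simps)
      moreover have "0 \<le> 27/4 * (h\<^sup>2 + 3/10 * h - 3/8)\<^sup>2" "0 \<le> 31/200 * (h - 65/248)\<^sup>2"
        by simp_all
      moreover have "0 < 13/256 - 31/200 * (65/248 :: real)\<^sup>2"
        by (simp add: power2_eq_square)
      ultimately show False using ret by linarith
    qed
  next
    case False
    define R where "R = - Q"
    have R: "0 < R" "R \<le> 4/5" using False l l2 by (auto simp: R_def)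
    have hR: "h = k * (1 - k) * (l - R * k)" by (simp add: h R_def)
    have h4: "h \<le> 2/5"
    proof -
      have "h \<le> k * (1 - k) * l" unfolding hR
        using kk R k by (intro mult_left_mono) auto
      then show ?thesis using hl by linarith
    qed
    have fin: False if "h \<le> m" "m * (1 + m) * (8/5 + r * m) < 1" "R \<le> r" for m r
    proof -
      have "h * (1 + h) * (l - Q * h) \<le> m * (1 + m) * (8/5 + r * m)"
        using that h0 l2 l R
        by (intro mult_mono add_mono) (auto simp: R_def[symmetric] intro!: mult_mono add_mono simp flip: add_uminus_conv_diff mult_minus_left)
      then show False using that ret by linarith
    qed
    show False
    proof (cases "R \<le> 23/50")
      case True
      show False by (rule fin[OF h4 _ True]) simp
    next
      case False
      have "h \<le> k * (1 - k) * (8/5 - 23/50 * k)" unfolding hR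
        using kk False k l2 by (intro mult_left_mono diff_mono mult_right_mono) auto
      also have "\<dots> \<le> 9/25"
      proof -
        \<comment> \<open>The cubic on the left is largest near k = 9/20; the factor is chosen to absorb its k^3 and k^2
              terms.\<close>
        have "0 \<le> (k - 9/20)\<^sup>2 * (823/500 - 23/50 * k)" using k by simp
        moreover have "9/25 - k * (1 - k) * (8/5 - 23/50 * k)
            = (k - 9/20)\<^sup>2 * (823/500 - 23/50 * k) + (5337/200000 - 509/20000 * k)"
          by (simp add: power2_eq_square field_simps)
        ultimately show ?thesis using k by linarith
      qed
      finally show False by (rule fin[OF _ _ R(2)]) simp
    qed
  qed
qed

lemma bump0_antimono:
  fixes x y :: real
  assumes "1/3 \<le> x" "x \<le> y" "y \<le> 1"
  shows "y * (1 - y)\<^sup>2 \<le> x * (1 - x)\<^sup>2"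
proof -
  have "x * (1 - x)\<^sup>2 - y * (1 - y)\<^sup>2
      = (y - x) * ((y - x) * x + (1 - y) * (3 * x - 1) + (1 - y) * (y - x))"
    by algebra
  moreover have "0 \<le> (y - x) * ((y - x) * x + (1 - y) * (3 * x - 1) + (1 - y) * (y - x))"
    using assms by (intro mult_nonneg_nonneg add_nonneg_nonneg) auto
  ultimately show ?thesis by linarith
qed

lemma bump0_le:
  fixes x :: real
  assumes "0 \<le> x" "x \<le> 1"
  shows "x * (1 - x)\<^sup>2 \<le> 4/27"
proof -
  have "4/27 - x * (1 - x)\<^sup>2 = (x - 1/3)\<^sup>2 * (4/3 - x)"
    by (simp add: power2_eq_square field_simps)
  moreover have "0 \<le> (x - 1/3)\<^sup>2 * (4/3 - x)" using assms by simp
  ultimately show ?thesis by linarith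
qed

lemma bump1_antimono:
  fixes x y :: real
  assumes "2/3 \<le> x" "x \<le> y"
  shows "y\<^sup>2 * (1 - y) \<le> x\<^sup>2 * (1 - x)"
proof -
  have "x\<^sup>2 * (1 - x) - y\<^sup>2 * (1 - y) = (y - x) * ((y - x) * (y + 2 * x - 1) + x * (3 * x - 2))"
    by algebra
  moreover have "0 \<le> (y - x) * ((y - x) * (y + 2 * x - 1) + x * (3 * x - 2))"
    using assms by (intro mult_nonneg_nonneg add_nonneg_nonneg) auto
  ultimately show ?thesis by linarith
qed

lemma bump1_mono:
  fixes x y :: real
  assumes "0 \<le> x" "x \<le> y" "y \<le> 1/2"
  shows "x\<^sup>2 * (1 - x) \<le> y\<^sup>2 * (1 - y)"
proof -
  have "y\<^sup>2 * (1 - y) - x\<^sup>2 * (1 - x) = (y - x) * (y * (1 - y) + x * (1 - y - x))"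
    by algebra
  moreover have "0 \<le> (y - x) * (y * (1 - y) + x * (1 - y - x))"
    using assms by (intro mult_nonneg_nonneg add_nonneg_nonneg) auto
  ultimately show ?thesis by linarith
qed

text \<open>
  To the right of its inflection point at 1/3 the bump is concave; it also stays below the tangent
  at z0 at all z with z + 2 z0 \<ge> 1.
\<close>

lemma bump1_le_tangent:
  fixes z :: real
  assumes "1 \<le> z + 2 * z0"
  shows "z\<^sup>2 * (1 - z) \<le> z0\<^sup>2 * (1 - z0) - (3 * z0\<^sup>2 - 2 * z0) * (z - z0)"
proof -
  have "0 \<le> (z - z0)\<^sup>2 * (z + 2 * z0 - 1)" using assms by simp
  then show ?thesis by (simp add: power2_eq_square algebra_simps)
qed

lemma cube_le_chord:
  fixes t :: real
  assumes "p \<le> t" "t \<le> q" "0 \<le> t + p + q"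
  shows "t ^ 3 \<le> (p\<^sup>2 + p * q + q\<^sup>2) * t - p * q * (p + q)"
proof -
  have "0 \<le> (t - p) * (q - t) * (t + p + q)" using assms by simp
  then show ?thesis by (simp add: power2_eq_square power3_eq_cube algebra_simps)
qed

text \<open>
  One-variable core of the estimate for the bump x (1 - x)^2. With b = 1 - a, the bump at
  a + l k is at most b (1 - b) (b - l k) because w (1 - w) grows up to 1/2, and the bump at a - k is
  expanded around b.
\<close>

lemma bump0_shift_bound:
  fixes a b l k C :: real
  assumes b: "b = 1 - a" "0 < b" "b \<le> 1/2" and l: "8 / 5 \<le> l" and k: "0 \<le> k" "l * k \<le> b"
    and C: "0 \<le> 3/8 * b\<^sup>2 * (1 - b) + k * (3 * b - 4 * b\<^sup>2 + k * (1 - 3 * b - k) - C)"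
  shows "(a + l * k) * (1 - (a + l * k))\<^sup>2 / l + C * k \<le> (a - k) * (1 - (a - k))\<^sup>2"
proof -
  define w where "w = b - l * k"
  have w: "0 \<le> w" "w \<le> b" using k l b by (auto simp: w_def)
  have l0: "0 < l" using l by simp
  have "0 \<le> (b - w) * (1 - w - b)" using w b by simp
  then have "w * (1 - w) \<le> b * (1 - b)" by (simp add: algebra_simps)
  then have "w * (w * (1 - w)) \<le> w * (b * (1 - b))" using w by (intro mult_left_mono) auto
  then have "w * (w * (1 - w)) / l \<le> w * (b * (1 - b)) / l"
    using l0 by (intro divide_right_mono) auto
  also have "w * (b * (1 - b)) / l = b * (1 - b) * (b / l - k)"
    using l0 by (simp add: w_def field_simps)
  also have "\<dots> \<le> b * (1 - b) * (5/8 * b - k)"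
  proof -
    have "b / l \<le> b / (8/5)" using b l by (intro divide_left_mono) auto
    then show ?thesis using b by (intro mult_left_mono) auto
  qed
  finally have 1: "(a + l * k) * (1 - (a + l * k))\<^sup>2 / l \<le> b * (1 - b) * (5/8 * b - k)"
    by (simp add: w_def b power2_eq_square algebra_simps)
  have "(a - k) * (1 - (a - k))\<^sup>2 - b * (1 - b) * (5/8 * b - k) - C * k
     = 3/8 * b\<^sup>2 * (1 - b) + k * (3 * b - 4 * b\<^sup>2 + k * (1 - 3 * b - k) - C)"
    unfolding b by (simp add: power2_eq_square field_simps)
  then show ?thesis using 1 C by linarith
qed

context concave_cubic
begin

text \<open>
  The length unit and the two parameters of the renormalised cubic are \<open>width\<close>, \<open>steep\<close> and
  \<open>skew\<close>. The tangent at the left preimage of a meets the vertical line at a at height a + \<open>room\<close>;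
  this excess is what the barrier can spend per climbing step.
\<close>

definition width where "width = a - pre"
definition skew where "skew = (A - B) * width\<^sup>2"
definition room where "room = dg pre * (a - pre)"

lemma width_pos: "0 < width" using pre by (simp add: width_def)

lemma steep_eq: "steep = width * (2 * A - B + (B - A) * (2 * a + pre))"
  using chord_diff[of A B a pre a] pre
  by (simp add: steep_def width_def chord_self algebra_simps)

lemma room_eq: "room = width * (steep + skew)"
proof -
  have "room = width\<^sup>2 * (2 * A - B + (B - A) * (a + 2 * pre))"
    using cub_taylor[of A B a pre] g_pre fix_a by (simp add: room_def width_def)
  also have "\<dots> = width * (steep + skew)"
    unfolding steep_eq skew_def width_def by algebra
  finally show ?thesis .
qed

lemma steep_plus_2skew: "0 \<le> steep + 2 * skew"
proof -
  have "steep + 2 * skew = width * (2 * A - B + (B - A) * (3 * pre))"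
    unfolding steep_eq skew_def width_def by algebra
  moreover have "0 \<le> 2 * A - B + (B - A) * (3 * pre)"
    using AB BA pre a_less by (intro bracket_nonneg) auto
  ultimately show ?thesis using width_pos by simp
qed

lemma chord_pre: "- chord A B a x = (x - pre) * (2 * A - B + (B - A) * (x + pre + a))"
  using chord_diff[of A B a pre x] pre by simp

text \<open>
  If an orbit jumps over a and lands so far left that it stays left once more, then g is steep
  at a. All quantities are expressed in units of \<open>width\<close>.
\<close>

lemma steep_ge:
  assumes x: "pre < x" "x < a" and ret: "g (g x) \<le> pre"
  shows "8 / 5 \<le> steep"
proof -
  define k where "k = (a - x) / width"
  define h where "h = (g x - a) / width"
  have k: "0 \<le> k" "k \<le> 1" using x width_pos by (auto simp: k_def width_def field_simps)
  have xk: "x = a - k * width" using width_pos by (simp add: k_def)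
  have zh: "g x = a + h * width" using width_pos by (simp add: h_def)
  have "g x - a = (a - x) * (- chord A B a x)" using g_eq[of x] by (simp add: algebra_simps)
  also have "\<dots> = width * (k * (1 - k) * (steep + skew * k))"
    unfolding chord_pre xk steep_eq skew_def width_def by algebra
  finally have h: "h = k * (1 - k) * (steep + skew * k)"
    using width_pos by (simp add: h_def)
  have "a - g (g x) = (g x - a) * (- chord A B a (g x))"
    using g_eq[of "g x"] by (simp add: algebra_simps)
  also have "\<dots> = width * (h * (1 + h) * (steep - skew * h))"
    unfolding chord_pre zh steep_eq skew_def width_def by algebra
  finally have "a - g (g x) = width * (h * (1 + h) * (steep - skew * h))" .
  moreover have "width \<le> a - g (g x)" using ret by (simp add: width_def)
  ultimately have "1 \<le> h * (1 + h) * (steep - skew * h)" using width_pos by simp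
  from renormalised_steepness_bound[OF k steep_pos steep_plus_2skew h this] show ?thesis .
qed

lemma fixed_point_equation: "(1 - a) * (A * (1 - a) + B * a) = 1"
  using fix_a a_pos unfolding cub_def mult.assoc by simp

lemma steep_expl: "steep = A * (1 - a) * (3 * a - 1) + B * a * (3 * a - 2)"
  by (simp add: steep_def dcub_def algebra_simps)

text \<open>
  Steepness pushes the fixed point to the right of 2/3, the maximum of x^2 (1 - x), so that both
  bumps decrease beyond a. The extreme case is A = 2 B.
\<close>

lemma a_ge:
  assumes "3 / 2 \<le> steep" shows "2 / 3 \<le> a"
proof (rule ccontr)
  assume "\<not> 2 / 3 \<le> a"
  then have a: "a < 2 / 3" by simp
  have "steep - 3/2 = A * (1 - a) * (9/2 * a - 5/2) + B * (a * (9/2 * a - 7/2))"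
    using fixed_point_equation unfolding steep_expl by algebra
  also have "B * (a * (9/2 * a - 7/2)) \<le> A / 2 * (a * (9/2 * a - 7/2))"
    using AB a a_pos by (intro mult_right_mono_neg) (auto simp: mult_le_0_iff)
  also have "A * (1 - a) * (9/2 * a - 5/2) + A / 2 * (a * (9/2 * a - 7/2))
      = - (9/4 * A * ((2/3 - a) * (5/3 - a)))"
    by (simp add: field_simps)
  also have "\<dots> < 0" using A_pos a by simp
  finally show False using assms by simp
qed

text \<open>
  The height bound A + B \<le> 8 keeps the fixed point away from 1. The extreme case is B = 2 A.
\<close>

lemma a_sq_le: "a\<^sup>2 \<le> 5 / 8"
proof (cases "a \<le> 1/2")
  case True
  then show ?thesis using a_pos power_mono[of a "1/2" 2] by (simp add: power2_eq_square)
next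
  case False
  have "A * (1 - a) + B * a = (A + B) * (1 + a) / 3 - (2 * a - 1) * (2 * A - B) / 3"
    by (simp add: field_simps)
  also have "\<dots> \<le> (A + B) * (1 + a) / 3" using False BA by simp
  also have "\<dots> \<le> 8 * (1 + a) / 3" using AB8 a_pos by (intro divide_right_mono mult_right_mono) auto
  finally have "1 \<le> (1 - a) * (8 * (1 + a) / 3)"
    using fixed_point_equation mult_left_mono[of "A * (1 - a) + B * a" "8 * (1 + a) / 3" "1 - a"] a_less by simp
  then show ?thesis by (simp add: power2_eq_square field_simps)
qed

lemma a_le: "a \<le> 3953 / 5000"
  using a_sq_le by (intro power2_le_imp_le[of a]) (auto simp: power2_eq_square)

text \<open>
  Whether A or B is larger decides the direction in which the cubic is skewed, and thus on which
  side of 1 - a the left preimage of a lies.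
\<close>

lemma g_flip: "g (1 - a) - a = a * (1 - a) * ((A - B) * (2 * a - 1))"
  using fixed_point_equation unfolding cub_def by algebra

lemma a_le_left: assumes "B \<le> A" "1/2 \<le> a" shows "a \<le> 3 / 4"
proof -
  have "A * (1 - a) + B * a = (A + B) / 2 - (A - B) * (2 * a - 1) / 2"
    by (simp add: field_simps)
  also have "\<dots> \<le> (A + B) / 2"
  proof -
    have "0 \<le> (A - B) * (2 * a - 1) / 2" using assms by simp
    then show ?thesis by (simp only: diff_le_eq le_add_same_cancel1)
  qed
  also have "\<dots> \<le> 4" using AB8 by simp
  finally have "1 \<le> (1 - a) * 4"
    using fixed_point_equation mult_left_mono[of "A * (1 - a) + B * a" 4 "1 - a"] a_less by simp
  then show ?thesis by simp
qed

lemma pre_le_left: assumes "B \<le> A" "1/2 \<le> a" shows "pre \<le> 1 - a"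
proof (rule ccontr)
  assume "\<not> ?thesis"
  then have "g (1 - a) < a" using below_pre[of "1 - a"] a_less by simp
  moreover have "0 \<le> a * (1 - a) * ((A - B) * (2 * a - 1))" using assms a_less by simp
  ultimately show False using g_flip by simp
qed

lemma pre_ge_right: assumes "A \<le> B" "1/2 < a" shows "1 - a \<le> pre"
proof (rule ccontr)
  assume "\<not> ?thesis"
  then have "a < g (1 - a)" using above_pre[of "1 - a"] assms by simp
  moreover have "0 \<le> a * (1 - a) * ((B - A) * (2 * a - 1))" using assms a_less by simp
  ultimately show False using g_flip by (simp add: algebra_simps)
qed

lemma steep_times_1_minus_a: "steep * (1 - a) = 2 * a - 1 - a * (1 - a)\<^sup>2 * (B - A)"
  using fixed_point_equation unfolding steep_expl by algebra

lemma a_ge_right: assumes "A \<le> B" "8 / 5 \<le> steep" shows "13 / 18 \<le> a"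
proof -
  have "8/5 * (1 - a) \<le> steep * (1 - a)" using assms a_less by (intro mult_right_mono) auto
  also have "\<dots> \<le> 2 * a - 1" using assms a_pos by (simp add: steep_times_1_minus_a)
  finally show ?thesis by simp
qed

text \<open>
  If B \<ge> A, the skewness cannot be large compared with the steepness. Both are compared with 1 by
  the fixed point equation, where the bound on B - A uses B \<le> 2 A.
\<close>

lemma skew_le: assumes "1/2 \<le> a" shows "(B - A) * (3 * a\<^sup>2 - 1) \<le> steep"
proof -
  have "(B - A) * (1 + a) \<le> A * (1 - a) + B * a" using BA by (simp add: algebra_simps)
  then have "(1 - a) * ((B - A) * (1 + a)) \<le> 1"
    using mult_left_mono[of "(B - A) * (1 + a)" "A * (1 - a) + B * a" "1 - a"] fixed_point_equation a_less
    by simp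
  then have "0 \<le> (2 * a - 1) * (1 - (1 - a) * ((B - A) * (1 + a)))" using assms by simp
  also have "\<dots> = (1 - a) * (steep - (B - A) * (3 * a\<^sup>2 - 1))"
    using steep_times_1_minus_a by algebra
  finally show ?thesis using a_less by (simp add: zero_le_mult_iff)
qed

text \<open>
  Among the admissible cubics with given a, the values on [0, a] are smallest for B = 2 A, that is
  for a multiple of x - x^3; the condition on p says that this one has reached height a at p.
\<close>

lemma pre_le_right:
  assumes p: "0 \<le> p" "p < a" "1 \<le> p\<^sup>2 + p * a + a\<^sup>2"
  shows "pre \<le> p"
proof (rule ccontr)
  assume "\<not> ?thesis"
  then have lt: "g p < a" using below_pre p by simp
  have pos: "0 < 1 - a\<^sup>2" using a_sq_le by simp
  have "(1 + p) * (A * (1 - a) + B * a) \<le> (1 + a) * (A * (1 - p) + B * p)"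
  proof -
    have "0 \<le> (2 * A - B) * (a - p)" using BA p by simp
    then show ?thesis by (simp add: algebra_simps)
  qed
  then have "p * (1 - p) * (1 - a) * ((1 + p) * (A * (1 - a) + B * a))
      \<le> p * (1 - p) * (1 - a) * ((1 + a) * (A * (1 - p) + B * p))"
    using p a_less by (intro mult_left_mono) auto
  moreover have "p * (1 - p) * (1 - a) * ((1 + p) * (A * (1 - a) + B * a)) = p - p ^ 3"
    using fixed_point_equation by algebra
  moreover have "p * (1 - p) * (1 - a) * ((1 + a) * (A * (1 - p) + B * p)) = g p * (1 - a\<^sup>2)"
    unfolding cub_def by algebra
  moreover have "p - p ^ 3 - a * (1 - a\<^sup>2) = (a - p) * (p\<^sup>2 + p * a + a\<^sup>2 - 1)" by algebra
  moreover have "0 \<le> (a - p) * (p\<^sup>2 + p * a + a\<^sup>2 - 1)" using p by simp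
  ultimately have "a * (1 - a\<^sup>2) \<le> g p * (1 - a\<^sup>2)" by linarith
  then show False using lt pos by simp
qed

text \<open>
  The next lemmas bound \<open>room\<close> from below by a multiple of \<open>steep\<close>. For B \<le> A the skewness helps.
  For A \<le> B it hurts, and the left preimage has to be located more precisely; there the range of a
  is split at 3/4, since the estimate that is sufficient for small a is too weak near the upper end.
\<close>

lemma room_ge_left:
  assumes "B \<le> A" "8 / 5 \<le> steep" shows "steep / 3 \<le> room"
proof -
  have a: "2/3 \<le> a" using a_ge assms by simp
  then have "pre \<le> 1 - a" using pre_le_left assms by simp
  then have width: "1/3 \<le> width" using a by (simp add: width_def)
  have "0 \<le> skew" using assms by (simp add: skew_def)
  then have "width * steep \<le> room" using width_pos by (simp add: room_eq)
  moreover have "1/3 * steep \<le> width * steep" using width steep_pos by (intro mult_right_mono) auto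
  ultimately show ?thesis by simp
qed

lemma room_ge_right_aux:
  assumes "A \<le> B" "1/2 \<le> a" "0 < D" "D \<le> 3 * a\<^sup>2 - 1" "r \<le> width - width ^ 3 / D"
  shows "r * steep \<le> room"
proof -
  have "(B - A) * D \<le> (B - A) * (3 * a\<^sup>2 - 1)" using assms by (intro mult_left_mono) auto
  also have "\<dots> \<le> steep" using skew_le assms by simp
  finally have "B - A \<le> steep / D" using assms by (simp add: field_simps)
  then have "(B - A) * width ^ 3 \<le> steep / D * width ^ 3" using width_pos by (intro mult_right_mono) auto
  moreover have "room = width * steep - (B - A) * width ^ 3" unfolding room_eq skew_def by algebra
  ultimately have "steep * (width - width ^ 3 / D) \<le> room" by (simp add: field_simps)
  moreover have "r * steep \<le> steep * (width - width ^ 3 / D)"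
    using assms steep_pos by (simp add: mult.commute mult_left_mono)
  ultimately show ?thesis by linarith
qed

lemma room_ge_right1:
  assumes "A \<le> B" "8 / 5 \<le> steep" "a \<le> 3/4" shows "1/4 * steep \<le> room"
proof -
  have a: "13/18 \<le> a" using a_ge_right assms by simp
  have a2: "(13/18)\<^sup>2 \<le> a\<^sup>2" using a by (intro power_mono) auto
  have "pre \<le> 21/50"
    using a a2 by (intro pre_le_right) (auto simp: power2_eq_square)
  then have L1: "34/113 \<le> width" using a by (simp add: width_def)
  have L2: "width \<le> 1/2" using pre_ge_right assms a by (simp add: width_def)
  have "width ^ 3 \<le> ((34/113)\<^sup>2 + 34/113 * (1/2) + (1/2)\<^sup>2) * width - 34/113 * (1/2) * (34/113 + 1/2)"
    using L1 L2 by (intro cube_le_chord) auto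
  then have "1/4 \<le> width - width ^ 3 / (61/108)" using L1 by (simp add: power2_eq_square)
  then show ?thesis
    using a2 a assms by (intro room_ge_right_aux[of "61/108"]) (auto simp: power2_eq_square)
qed

lemma room_ge_right2:
  assumes "A \<le> B" "8 / 5 \<le> steep" "3/4 \<le> a" shows "57/200 * steep \<le> room"
proof -
  have a: "3/4 \<le> a" "a \<le> 4/5" using a_le assms by simp_all
  have a2: "(3/4)\<^sup>2 \<le> a\<^sup>2" using a by (intro power_mono) auto
  have "pre \<le> 39/100"
    using a a2 by (intro pre_le_right) (auto simp: power2_eq_square)
  then have L1: "9/25 \<le> width" using a by (simp add: width_def)
  have L2: "width \<le> 3/5" using pre_ge_right assms a by (simp add: width_def)
  have "width ^ 3 \<le> ((9/25)\<^sup>2 + 9/25 * (3/5) + (3/5)\<^sup>2) * width - 9/25 * (3/5) * (9/25 + 3/5)"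
    using L1 L2 by (intro cube_le_chord) auto
  then have "57/200 \<le> width - width ^ 3 / (11/16)" using L1 L2 by (simp add: power2_eq_square)
  then show ?thesis
    using a2 a assms by (intro room_ge_right_aux[of "11/16"]) (auto simp: power2_eq_square)
qed

lemma room_pos: assumes "8/5 \<le> steep" shows "0 < room"
  using room_ge_left room_ge_right1 room_ge_right2 assms by (smt (verit, best) mult_pos_pos divide_pos_pos)

text \<open>
  The turning point is at least 1 - 1/sqrt 3, attained for A = 2 B, and 21/50 is just below it.
\<close>

lemma descending_point_ge: assumes "0 \<le> x" "dg x \<le> 0" shows "21/50 \<le> x"
proof (rule ccontr)
  assume "\<not> ?thesis"
  then have x: "x < 21/50" by simp
  have "A / 2 * (x * (2 - 3 * x)) \<le> B * (x * (2 - 3 * x))"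
    using AB assms x by (intro mult_right_mono) auto
  moreover have "A * (1 - 3 * x + 3/2 * x\<^sup>2) =
      A * (1 - x) * (1 - 3 * x) + A / 2 * (x * (2 - 3 * x))"
    by (simp add: power2_eq_square field_simps)
  moreover have "0 < 1 - 3 * x + 3/2 * x\<^sup>2"
  proof -
    have "0 \<le> (x - 21/50)\<^sup>2" by simp
    then show ?thesis using x by (simp add: power2_eq_square algebra_simps)
  qed
  ultimately have "0 < dg x" unfolding dcub_def using A_pos
    by (smt (verit, best) mult.assoc mult_pos_pos)
  then show False using assms by simp
qed

lemma descending_point_ge_right: assumes "A \<le> B" "0 \<le> x" "dg x \<le> 0" shows "1/2 \<le> x"
proof (rule ccontr)
  assume "\<not> ?thesis"
  then have x: "x < 1/2" by simp
  have "A * (x * (2 - 3 * x)) \<le> B * (x * (2 - 3 * x))"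
    using assms x by (intro mult_right_mono) auto
  then have "A * (1 - 2 * x) \<le> dg x" unfolding dcub_def by (simp add: algebra_simps)
  moreover have "0 < A * (1 - 2 * x)" using A_pos x by simp
  ultimately show False using assms by simp
qed

text \<open>
  Here r is a lower bound for \<open>room\<close> / \<open>steep\<close>, and by the tangent at a, a point x to the
  left of a with g x = a + \<open>steep\<close> k satisfies x \<le> a - k.
\<close>

lemma bump0_margin_aux:
  assumes l: "8/5 \<le> steep" and k: "0 \<le> k" "a + steep * k \<le> 1"
    and room: "0 < r" "r * steep \<le> room" and C: "C = 4 / (27 * r)"
    and ineq: "0 \<le> 3/8 * (1 - a)\<^sup>2 * a + k * (3 * (1 - a) - 4 * (1 - a)\<^sup>2 + k * (1 - 3 * (1 - a) - k) - C)"
    and x: "1/3 \<le> x" "x \<le> a - k" 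
  shows "(a + steep * k) * (1 - (a + steep * k))\<^sup>2 / steep + 4/27 * (steep * k) / room \<le> x * (1 - x)\<^sup>2"
proof -
  have a: "2/3 \<le> a" using a_ge l by simp
  have "0 < r * steep" using room steep_pos by simp
  then have "4/27 * (steep * k) / room \<le> 4/27 * (steep * k) / (r * steep)"
    using room k steep_pos less_le_trans[of 0 "r * steep" room] by (intro divide_left_mono mult_pos_pos) auto
  also have "\<dots> = C * k" using l room C by simp
  finally have 1: "4/27 * (steep * k) / room \<le> C * k" .
  have 2: "(a + steep * k) * (1 - (a + steep * k))\<^sup>2 / steep + C * k \<le> (a - k) * (1 - (a - k))\<^sup>2"
    by (rule bump0_shift_bound[where b = "1 - a"]) (use a a_less l k ineq in auto)
  have 3: "(a - k) * (1 - (a - k))\<^sup>2 \<le> x * (1 - x)\<^sup>2"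
    using x k a_less by (intro bump0_antimono) auto
  show ?thesis using 1 2 3 by linarith
qed

text \<open>
  The polynomial inequality holds for 0 \<le> k \<le> 5/8 (1 - a) with the values of r from the bounds on
  \<open>room\<close>. For B \<le> A the factor of k is nonnegative. Otherwise it may be slightly negative, and
  the term that is free of k makes up for it.
\<close>

lemma bump0_margin_polynomial:
  assumes l: "8/5 \<le> steep" and k: "0 \<le> k" "a + steep * k \<le> 1"
  shows "\<exists>r>0. r * steep \<le> room \<and> 0 \<le> 3/8 * (1 - a)\<^sup>2 * a
      + k * (3 * (1 - a) - 4 * (1 - a)\<^sup>2 + k * (1 - 3 * (1 - a) - k) - 4 / (27 * r))"
proof -
  define b where "b = 1 - a"
  have a: "2/3 \<le> a" using a_ge l by simp
  have b: "1047/5000 \<le> b" "b \<le> 1/3" using a a_le by (auto simp: b_def)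
  have "8/5 * k \<le> steep * k" using l k by (intro mult_right_mono) auto
  then have kb: "k \<le> 5/8 * b" using k by (simp add: b_def)
  have "\<exists>r>0. r * steep \<le> room \<and> 0 \<le> 3/8 * b\<^sup>2 * (1 - b)
      + k * (3 * b - 4 * b\<^sup>2 + k * (1 - 3 * b - k) - 4 / (27 * r))"
  proof (cases "B \<le> A")
    case True
    have b4: "1/4 \<le> b" using a_le_left True a by (simp add: b_def)
    have k2: "k * k \<le> 5/8 * b * (5/8 * b)" using kb k b by (intro mult_mono) auto
    have "0 \<le> (b - 1/4) * (1/3 - b)" using b b4 by simp
    then have bb: "b * b \<le> 7/12 * b - 1/12" by (simp add: algebra_simps)
    have "0 \<le> k * (1 - 3 * b)" using k b by simp
    then have "0 \<le> 3 * b - 4 * b\<^sup>2 + k * (1 - 3 * b - k) - 4 / (27 * (1/3))"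
      using k2 bb b4 unfolding power2_eq_square right_diff_distrib by simp
    then have "0 \<le> 3/8 * b\<^sup>2 * (1 - b)
      + k * (3 * b - 4 * b\<^sup>2 + k * (1 - 3 * b - k) - 4 / (27 * (1/3)))"
      using k b by (intro add_nonneg_nonneg mult_nonneg_nonneg) auto
    then show ?thesis using room_ge_left[OF True l] by (intro exI[of _ "1/3"]) auto
  next
    case False
    then have AB': "A \<le> B" by simp
    have b5: "b \<le> 5/18" using a_ge_right[OF AB' l] by (simp add: b_def)
    \<comment> \<open>It suffices that the factor of k is at least -m, for b in [p, q].\<close>
    have fin: ?thesis if r: "0 < r" "r * steep \<le> room" and bd: "p \<le> b" "b \<le> q" "0 \<le> p" "q \<le> 1"
      and m: "- m \<le> 3 * b - 4 * b\<^sup>2 + k * (1 - 3 * b - k) - 4 / (27 * r)"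
      and pm: "m * (5/8 * q) \<le> 3/8 * p\<^sup>2 * (1 - q)" "0 \<le> m" for r p q m
    proof -
      have "k * (- m) \<le> k * (3 * b - 4 * b\<^sup>2 + k * (1 - 3 * b - k) - 4 / (27 * r))"
        using m k by (intro mult_left_mono) auto
      moreover have "k * m \<le> 5/8 * q * m" using kb bd pm by (intro mult_right_mono) auto
      moreover have "3/8 * p\<^sup>2 * (1 - q) \<le> 3/8 * b\<^sup>2 * (1 - b)"
        using bd b by (intro mult_mono power_mono) auto
      ultimately have "0 \<le> 3/8 * b\<^sup>2 * (1 - b)
        + k * (3 * b - 4 * b\<^sup>2 + k * (1 - 3 * b - k) - 4 / (27 * r))"
        using pm by (simp only: mult.commute[of _ m] mult_minus_right)
      then show ?thesis using r by blast
    qed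
    show ?thesis
    proof (cases "a \<le> 3/4")
      case True
      then have b4: "1/4 \<le> b" by (simp add: b_def)
      have "0 \<le> (b - 1/4) * (5/18 - b)" using b5 b4 by simp
      then have bb: "b * b \<le> 19/36 * b - 5/72" by (simp add: field_simps)
      have "k * (k - 1/6) \<le> 7/5000"
      proof (cases "k \<le> 1/6")
        case True
        then have "k * (k - 1/6) \<le> 0" using k by (simp add: mult_le_0_iff)
        then show ?thesis by simp
      next
        case False
        have "k * (k - 1/6) \<le> 1/5 * (7/1000)" using kb k b5 False by (intro mult_mono) auto
        then show ?thesis by simp
      qed
      moreover have "k * (1/6 - k) \<le> k * (1 - 3 * b - k)"
        using k b5 by (intro mult_left_mono) auto
      ultimately have kk: "- 7/5000 \<le> k * (1 - 3 * b - k)" by (simp add: algebra_simps)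
      show ?thesis
      proof (rule fin[of "1/4" "1/4" "5/18" "95/1000"])
        have "- (95/1000) \<le> 3 * b - 4 * (b * b) + k * (1 - 3 * b - k) - 16/27"
          using kk bb b4 by linarith
        then show "- (95/1000) \<le> 3 * b - 4 * b\<^sup>2 + k * (1 - 3 * b - k) - 4 / (27 * (1/4))"
          by (simp add: power2_eq_square)
      qed (use room_ge_right1[OF AB' l True] b4 b5 in \<open>simp_all add: power2_eq_square\<close>)
    next
      case False
      then have b4: "b \<le> 1/4" by (simp add: b_def)
      have "0 \<le> (b - 1047/5000) * (1/4 - b)" using b b4 by simp
      then have bb: "b * b \<le> (1047/5000 + 1/4) * b - 1047/20000" by (simp add: field_simps)
      have kk: "0 \<le> k * (1 - 3 * b - k)" using k kb b4 by simp
      show ?thesis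
      proof (rule fin[of "57/200" "1047/5000" "1/4" "68/1000"])
        have "4 * (b * b) \<le> 2297/1250 * b - 1047/5000"
          using bb by (simp add: field_simps)
        then have "- (68/1000) \<le> 3 * b - 4 * (b * b) - 800/1539"
          using b(1) by linarith
        then have "- (68/1000) \<le> 3 * b - 4 * (b * b) + k * (1 - 3 * b - k) - 800/1539"
          using kk by linarith
        then show "- (68/1000) \<le> 3 * b - 4 * b\<^sup>2 + k * (1 - 3 * b - k) - 4 / (27 * (57/200))"
          by (simp add: power2_eq_square)
      qed (use room_ge_right2[OF AB' l] b b4 False in \<open>simp_all add: power2_eq_square\<close>)
    qed
  qed
  then show ?thesis by (simp add: b_def)
qed

text \<open>
  The jump inequality for the bump x (1 - x)^2, divided by the slope: the bump at x pays for the
  bump at z = g x and for the barrier. The bump is at most 4/27 on the climbing branch.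
\<close>

lemma bump0_margin:
  assumes l: "8/5 \<le> steep" and z: "a \<le> z" "z \<le> 1" and x: "1/3 \<le> x" "x \<le> a - (z - a) / steep"
  shows "z * (1 - z)\<^sup>2 / steep + 4/27 * (z - a) / room \<le> x * (1 - x)\<^sup>2"
proof -
  define k where "k = (z - a) / steep"
  have zk: "z = a + steep * k" using steep_pos by (simp add: k_def)
  have "0 \<le> k" using z steep_pos by (simp add: k_def)
  moreover have "a + steep * k \<le> 1" using z(2) unfolding zk .
  ultimately have k: "0 \<le> k" "a + steep * k \<le> 1" by auto
  obtain r where "0 < r" "r * steep \<le> room" "0 \<le> 3/8 * (1 - a)\<^sup>2 * a
      + k * (3 * (1 - a) - 4 * (1 - a)\<^sup>2 + k * (1 - 3 * (1 - a) - k) - 4 / (27 * r))"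
    using bump0_margin_polynomial[OF l k] by blast
  from bump0_margin_aux[OF l k this(1,2) refl this(3) x(1)] x(2)
  have "(a + steep * k) * (1 - (a + steep * k))\<^sup>2 / steep + 4/27 * (steep * k) / room \<le> x * (1 - x)\<^sup>2"
    by (simp add: k_def[symmetric])
  moreover have "steep * k = z - a" using zk by simp
  ultimately show ?thesis by (simp add: zk[symmetric] k_def[symmetric])
qed

text \<open>
  The jump inequality for the bump x^2 (1 - x). On the climbing branch this bump is largest at the
  left preimage of a. Both z-terms are bounded by linear functions, the first one by a tangent, and
  x is bounded below by the location of the turning point.
\<close>

lemma bump1_margin:
  assumes l: "8/5 \<le> steep" and z: "a \<le> z" "z \<le> 1" and x: "0 \<le> x" "x \<le> a" "dg x \<le> 0"
  shows "z\<^sup>2 * (1 - z) / steep + pre\<^sup>2 * (1 - pre) * (z - a) / room \<le> x\<^sup>2 * (1 - x)"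
proof -
  have a: "2/3 \<le> a" using a_ge l by simp
  have z1: "z\<^sup>2 * (1 - z) / steep \<le> 5/8 * (z\<^sup>2 * (1 - z))"
    using z a l divide_left_mono[of "8/5" steep "z\<^sup>2 * (1 - z)"] by simp
  have x_mono: "p\<^sup>2 * (1 - p) \<le> x\<^sup>2 * (1 - x)" if "p \<le> x" "0 \<le> (x + p) - (x\<^sup>2 + x * p + p\<^sup>2)" for p
  proof -
    have "x\<^sup>2 * (1 - x) - p\<^sup>2 * (1 - p) = (x - p) * ((x + p) - (x\<^sup>2 + x * p + p\<^sup>2))"
      by algebra
    moreover have "0 \<le> (x - p) * ((x + p) - (x\<^sup>2 + x * p + p\<^sup>2))"
      using that by (intro mult_nonneg_nonneg) auto
    ultimately show ?thesis by linarith
  qed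
  have fin: ?thesis if M: "pre \<le> p" "p \<le> 1/2" and r: "r * steep \<le> room" "0 < r"
    and X: "p' \<le> x" "0 \<le> (x + p') - (x\<^sup>2 + x * p' + p'\<^sup>2)"
    and z0: "1/2 \<le> z0" and N: "5/8 * (z0\<^sup>2 * (1 - z0) - (3 * z0\<^sup>2 - 2 * z0) * (z - z0))
        + p\<^sup>2 * (1 - p) / (r * (8/5)) * (z - a) \<le> p'\<^sup>2 * (1 - p')" for p p' r z0
  proof -
    have room: "r * (8/5) \<le> room" by (rule order.trans[OF mult_left_mono[OF l] r(1)]) (use r in simp)
    have "pre\<^sup>2 * (1 - pre) * (z - a) / room \<le> p\<^sup>2 * (1 - p) * (z - a) / (r * (8/5))"
    proof (rule frac_le)
      show "0 \<le> p\<^sup>2 * (1 - p) * (z - a)" using M z by simp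
      show "pre\<^sup>2 * (1 - pre) * (z - a) \<le> p\<^sup>2 * (1 - p) * (z - a)"
        using bump1_mono[of pre p] M pre z by (intro mult_right_mono) auto
    qed (use room r in auto)
    also have "\<dots> = p\<^sup>2 * (1 - p) / (r * (8/5)) * (z - a)" by simp
    finally have 1: "pre\<^sup>2 * (1 - pre) * (z - a) / room \<le> p\<^sup>2 * (1 - p) / (r * (8/5)) * (z - a)" .
    have "z\<^sup>2 * (1 - z) \<le> z0\<^sup>2 * (1 - z0) - (3 * z0\<^sup>2 - 2 * z0) * (z - z0)"
      using z0 z a by (intro bump1_le_tangent) auto
    then have "5/8 * (z\<^sup>2 * (1 - z)) \<le> 5/8 * (z0\<^sup>2 * (1 - z0) - (3 * z0\<^sup>2 - 2 * z0) * (z - z0))"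
      by (intro mult_left_mono) auto
    from order.trans[OF order.trans[OF add_mono[OF order.trans[OF z1 this] 1] N] x_mono[OF X]]
    show ?thesis .
  qed
  show ?thesis
  proof (cases "B \<le> A")
    case True
    have x2: "21/50 \<le> x" "x \<le> 3/4" using descending_point_ge x a_le_left[OF True] a by auto
    then have "0 \<le> (x - 21/50) * (3/4 - x)" by simp
    then have xx: "x * x \<le> 117/100 * x - 63/200" by (simp add: field_simps)
    show ?thesis
      \<comment> \<open>The tangent point 153/200 makes the slopes of the two z-terms nearly cancel.\<close>
      by (rule fin[of "1/3" "1/3" "21/50" "153/200"])
        (use pre_le_left[OF True] room_ge_left[OF True l] x2 xx a z in \<open>auto simp: power2_eq_square field_simps\<close>)
  next
    case False
    then have AB': "A \<le> B" by simp
    have a': "13/18 \<le> a" using a_ge_right[OF AB' l] .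
    have a2: "(13/18)\<^sup>2 \<le> a\<^sup>2" using a' by (intro power_mono) auto
    have p: "pre \<le> 21/50"
      using a' a2 by (intro pre_le_right) (auto simp: power2_eq_square)
    have room: "1/4 * steep \<le> room"
      using room_ge_right1[OF AB' l] room_ge_right2[OF AB' l] steep_pos by (cases "a \<le> 3/4") auto
    have x2: "1/2 \<le> x" "x \<le> 3953/5000" using descending_point_ge_right[OF AB'] x a_le by auto
    then have "0 \<le> (x - 1/2) * (3953/5000 - x)" by simp
    then have xx: "x * x \<le> (1/2 + 3953/5000) * x - 3953/10000" by (simp add: field_simps)
    show ?thesis
      \<comment> \<open>Again 83/100 is the tangent point for which the slopes nearly cancel.\<close>
      by (rule fin[of "21/50" "1/4" "1/2" "83/100"])
        (use p room x2 xx a' z in \<open>auto simp: power2_eq_square field_simps\<close>)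
  qed
qed

end


section \<open>Orbits of two ordered cubics\<close>

context concave_cubic
begin

lemma pre_half: assumes l: "8/5 \<le> steep" shows "pre \<le> 1/2"
proof (cases "B \<le> A")
  case True
  have a: "2/3 \<le> a" using a_ge l by simp
  then show ?thesis using pre_le_left[OF True] by simp
next
  case False
  then have AB': "A \<le> B" by simp
  have a': "13/18 \<le> a" using a_ge_right[OF AB' l] .
  have a2: "(13/18)\<^sup>2 \<le> a\<^sup>2" using a' by (intro power_mono) auto
  show ?thesis
    using a' a2 by (intro pre_le_right) (auto simp: power2_eq_square)
qed

context
  fixes A' B' :: real
  assumes A': "0 \<le> A'" and B': "0 \<le> B'" and l: "8/5 \<le> steep"
begin

text \<open>
  In the following f exceeds g by D, and M bounds D on the climbing branch [0, \<open>pre\<close>]; it is a sum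
  of the bounds for the two bumps. M / \<open>room\<close> is the constant K of the barrier.
\<close>

abbreviation D where "D \<equiv> cub A' B'"
abbreviation f where "f \<equiv> cub (A + A') (B + B')"
definition M where "M = A' * (4/27) + B' * (pre\<^sup>2 * (1 - pre))"

lemma f_eq: "f x = g x + D x" by (rule cub_add)

lemma M_nonneg: "0 \<le> M" using A' B' pre a_less by (simp add: M_def)

lemma D_antimono: "2/3 \<le> x \<Longrightarrow> x \<le> y \<Longrightarrow> y \<le> 1 \<Longrightarrow> D y \<le> D x"
  unfolding cub_split using A' B'
  by (intro add_mono mult_left_mono bump0_antimono bump1_antimono) auto

lemma D_le_M: "0 \<le> u \<Longrightarrow> u \<le> pre \<Longrightarrow> D u \<le> M"
  unfolding cub_split M_def using A' B' pre pre_half[OF l] a_less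
  by (intro add_mono mult_left_mono bump0_le bump1_mono) auto

text \<open>
  The first step moves f ahead of g by D x. As g falls with slope at least G behind z = g x, the
  second step turns this into a lag of at least G D x, from which D z has to be subtracted. By the
  two margins the rest is at least K G (z - a), and G (z - a) \<ge> a - g z by concavity.
\<close>

lemma two_steps:
  assumes x: "0 \<le> x" "x < a" "dg x \<le> 0" and z: "a \<le> g x" and fx: "f x \<le> 1"
  shows "f (f x) \<le> g (g x) - M / room * (a - g (g x))" and "f (f x) \<le> g (g x)"
proof -
  have a: "2/3 \<le> a" using a_ge l by simp
  have Tp: "0 < room" using room_pos[OF l] .
  define z where "z = g x"
  define G where "G = - dg z"
  have D0: "0 \<le> D x" "0 \<le> D z"
  proof -
    show "0 \<le> D x" using cub_nonneg[OF A' B'] x a_less by simp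
    then have "z \<le> 1" using fx unfolding f_eq z_def by linarith
    then show "0 \<le> D z" using cub_nonneg[OF A' B'] z a_pos by (simp add: z_def)
  qed
  have z1: "a \<le> z" "z \<le> 1" using z fx D0 unfolding f_eq z_def by linarith+
  have Gl: "steep \<le> G" unfolding steep_def G_def
    using dcub_antimono[OF AB BA, of a z] z1 a_pos by simp
  have "z \<le> a - steep * (x - a)"
    using tangent[of x a] x a_less a_pos fix_a by (simp add: z_def steep_def)
  then have xk: "x \<le> a - (z - a) / steep" using steep_pos by (simp add: field_simps)
  have x3: "1/3 \<le> x" using descending_point_ge[of x] x by simp
  have e0: "z * (1 - z)\<^sup>2 / steep + 4/27 * (z - a) / room \<le> x * (1 - x)\<^sup>2"
    using bump0_margin[OF l z1 x3 xk] .
  have e1: "z\<^sup>2 * (1 - z) / steep + pre\<^sup>2 * (1 - pre) * (z - a) / room \<le> x\<^sup>2 * (1 - x)"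
    using bump1_margin[OF l z1] x by simp
  have "D z / steep + M / room * (z - a)
      = A' * (z * (1 - z)\<^sup>2 / steep + 4/27 * (z - a) / room)
      + B' * (z\<^sup>2 * (1 - z) / steep + pre\<^sup>2 * (1 - pre) * (z - a) / room)"
    unfolding cub_split M_def using Tp steep_pos by (simp add: field_simps)
  also have "\<dots> \<le> D x" unfolding cub_split[of A' B' x]
    using e0 e1 A' B' by (intro add_mono mult_left_mono) auto
  finally have "G * (D z / steep + M / room * (z - a)) \<le> G * D x"
    using Gl steep_pos by (intro mult_left_mono) auto
  moreover have "D z \<le> G * (D z / steep)"
    using Gl steep_pos D0 mult_right_mono[of steep G "D z / steep"] by simp
  ultimately have key: "D z + M / room * (G * (z - a)) \<le> G * D x"
    by (simp add: algebra_simps)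
  have fz: "f (f x) \<le> g z + dg z * D x + D z"
  proof -
    have fx': "f x = z + D x" by (simp add: f_eq z_def)
    have "g (f x) \<le> g z + dg z * (f x - z)"
      using tangent[of "f x" z] z1 fx fx' D0 a_pos by auto
    moreover have "D (f x) \<le> D z" using D_antimono[of z "f x"] fx' z1 D0 fx a by simp
    ultimately show ?thesis unfolding f_eq[of "f x"] using fx' by simp
  qed
  have tz: "a - g z \<le> G * (z - a)"
    using tangent[of a z] z1 a_pos a_less fix_a by (simp add: G_def algebra_simps)
  have MT: "0 \<le> M / room" using M_nonneg Tp by simp
  have fz': "f (f x) \<le> g z + D z - G * D x" using fz by (simp add: G_def)
  have "M / room * (a - g z) \<le> M / room * (G * (z - a))" using tz MT by (rule mult_left_mono)
  then show "f (f x) \<le> g (g x) - M / room * (a - g (g x))"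
    using key fz' unfolding z_def[symmetric] by linarith
  have "0 \<le> M / room * (G * (z - a))" using Gl steep_pos z1 by (intro mult_nonneg_nonneg[OF MT]) auto
  then show "f (f x) \<le> g (g x)"
    using key fz' unfolding z_def[symmetric] by linarith
qed

text \<open>
  The barrier y - K (a - y) is an affine function of y that fixes a. By concavity of g the lag is
  multiplied at least by the slope of g at y, and the tangent at y reaches at least the height
  a + \<open>room\<close> at a; so after one step the lag exceeds K (a - g y) by K \<open>room\<close> = M, which covers D u.
\<close>

lemma climb_step:
  assumes u: "0 \<le> u" "u \<le> y - M / room * (a - y)" and y: "y \<le> pre"
  shows "f u \<le> g y - M / room * (a - g y)"
proof -
  have Tp: "0 < room" using room_pos[OF l] .
  define K where "K = M / room"
  have MT: "0 \<le> K" using M_nonneg Tp by (simp add: K_def)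
  have u2: "u \<le> y - K * (a - y)" using u(2) by (simp only: K_def)
  have "0 \<le> K * (a - y)" by (rule mult_nonneg_nonneg[OF MT]) (use y pre in simp)
  then have uy: "u \<le> y" using u2 by linarith
  then have y0: "0 \<le> y" using u by linarith
  have dg: "0 \<le> dg y" using dg_pre_nonneg y y0 by simp
  have "g u \<le> g y + dg y * (u - y)" using tangent[of u y] u uy y pre a_less by auto
  also have "dg y * (u - y) \<le> dg y * (- (K * (a - y)))"
    using u2 dg by (intro mult_left_mono) auto
  finally have 1: "g u \<le> g y - K * (dg y * (a - y))" by (simp add: algebra_simps)
  have Ty: "room \<le> g y + dg y * (a - y) - a"
  proof -
    have "a \<le> g y + dg y * (pre - y)" using tangent[of pre y] g_pre y y0 pre a_less by simp
    moreover have "dg pre * (a - pre) \<le> dg y * (a - pre)"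
      using dcub_antimono[OF AB BA, of y pre] y y0 pre a_less by (intro mult_right_mono) auto
    ultimately show ?thesis unfolding room_def by (simp add: algebra_simps)
  qed
  have "M = K * room" using Tp by (simp add: K_def)
  also have "\<dots> \<le> K * (g y + dg y * (a - y) - a)" using Ty MT by (rule mult_left_mono)
  finally have 2: "M + K * (a - g y) \<le> K * (dg y * (a - y))" by (simp add: algebra_simps)
  have "D u \<le> M" using D_le_M u uy y by simp
  then have "f u \<le> g y - K * (a - g y)" using 1 2 unfolding f_eq by linarith
  then show ?thesis by (simp only: K_def)
qed

text \<open>
  The main comparison: f, although larger than g, stays behind g from a jump over a until the
  orbit of g has climbed above its left preimage of a. For k = 0 the orbit of g jumps again
  at once.
\<close>

lemma orbit_comparison:
  assumes maps: "\<And>t. t \<in> {0..1} \<Longrightarrow> f t \<in> {0..1}"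
    and x: "0 \<le> x" "x < a" "dg x \<le> 0" and z: "a < g x"
    and low: "\<And>j. j < k \<Longrightarrow> (g ^^ j) (g (g x)) \<le> pre"
  shows "(f ^^ k) (f (f x)) \<le> (g ^^ k) (g (g x))"
proof -
  have fx: "f x \<in> {0..1}" using maps x a_less by simp
  then have x2: "0 \<le> f (f x)" "f (f x) \<in> {0..1}" using maps by auto
  have inv: "(f ^^ j) (f (f x)) \<in> {0..1} \<and>
    (f ^^ j) (f (f x)) \<le> (g ^^ j) (g (g x)) - M / room * (a - (g ^^ j) (g (g x)))" if "j \<le> k" for j
    using that
  proof (induction j)
    case 0
    then show ?case using two_steps(1)[OF x] z fx x2 by simp
  next
    case (Suc j)
    then show ?case using climb_step[of "(f ^^ j) (f (f x))"] low[of j] maps by simp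
  qed
  have MT: "0 \<le> M / room" using M_nonneg room_pos[OF l] by simp
  show ?thesis
  proof (cases k)
    case 0
    then show ?thesis using two_steps(2)[OF x] z fx by simp
  next
    case (Suc j)
    have le: "(g ^^ j) (g (g x)) \<le> pre" using low[of j] Suc by simp
    have "0 \<le> (g ^^ j) (g (g x))"
    proof -
      have "0 \<le> M / room * (a - (g ^^ j) (g (g x)))" by (rule mult_nonneg_nonneg[OF MT]) (use le pre in simp)
      then show ?thesis using inv[of j] Suc by auto
    qed
    then have "g ((g ^^ j) (g (g x))) \<le> a"
      using below_pre[of "(g ^^ j) (g (g x))"] g_pre le by (cases "(g ^^ j) (g (g x)) = pre") auto
    then have "0 \<le> a - (g ^^ k) (g (g x))" using Suc by simp
    then have "0 \<le> M / room * (a - (g ^^ k) (g (g x)))" by (rule mult_nonneg_nonneg[OF MT])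
    then show ?thesis using inv[of k] by linarith
  qed
qed

end
end


section \<open>Periodic points from loops of covering segments\<close>

lemma ivt_segment:
  fixes H :: "real \<Rightarrow> real"
  assumes "continuous_on (closed_segment p q) H" "c \<in> closed_segment (H p) (H q)"
  shows "\<exists>x\<in>closed_segment p q. H x = c"
proof -
  have "connected (H ` closed_segment p q)"
    by (intro connected_continuous_image assms connected_segment)
  then have "closed_segment (H p) (H q) \<subseteq> H ` closed_segment p q"
    by (intro closed_segment_subset) (auto simp: connected_convex_1)
  then show ?thesis using assms by auto
qed

text \<open>
  Among all pairs of preimages of c and d a closest one is chosen: a point between them whose image
  leaves the segment from c to d would give a closer pair, by the intermediate value theorem.
\<close>

lemma tight_subsegment:
  fixes H :: "real \<Rightarrow> real"
  assumes cont: "continuous_on (closed_segment p q) H"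
    and cd: "closed_segment c d \<subseteq> closed_segment (H p) (H q)"
  shows "\<exists>s t. s \<in> closed_segment p q \<and> t \<in> closed_segment p q \<and> H s = c \<and> H t = d
    \<and> H ` closed_segment s t \<subseteq> closed_segment c d"
proof -
  define P where "P = (\<lambda>c. {s \<in> closed_segment p q. H s = c})"
  have comp: "compact (P c)" for c
  proof -
    have "P c = closed_segment p q \<inter> H -` {c}" by (auto simp: P_def)
    moreover have "closed (closed_segment p q \<inter> H -` {c})"
      using cont by (intro continuous_closed_preimage) auto
    ultimately show ?thesis
      using compact_Int_closed[of "closed_segment p q"] by (metis compact_segment inf.left_idem)
  qed
  have "P c \<noteq> {}" "P d \<noteq> {}"
    using ivt_segment[OF cont] cd by (force simp: P_def)+
  then have "compact (P c \<times> P d)" "P c \<times> P d \<noteq> {}"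
    using comp by (auto intro: compact_Times)
  moreover have "continuous_on (P c \<times> P d) (\<lambda>z. dist (fst z) (snd z))"
    by (intro continuous_intros)
  ultimately obtain z where z: "z \<in> P c \<times> P d"
    "\<And>y. y \<in> P c \<times> P d \<Longrightarrow> dist (fst z) (snd z) \<le> dist (fst y) (snd y)"
    using continuous_attains_inf[of "P c \<times> P d" "\<lambda>z. dist (fst z) (snd z)"] by metis
  define s t where "s = fst z" and "t = snd z"
  have st: "s \<in> closed_segment p q" "t \<in> closed_segment p q" "H s = c" "H t = d"
    using z(1) by (auto simp: P_def s_def t_def)
  have sub: "closed_segment s t \<subseteq> closed_segment p q"
    using st by (simp add: subset_closed_segment)
  have "H w \<in> closed_segment c d" if w: "w \<in> closed_segment s t" for w
  proof (rule ccontr)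
    assume out: "H w \<notin> closed_segment c d"
    then have "w \<noteq> s" "w \<noteq> t" using st by auto
    then have lt: "dist s w < dist s t" "dist w t < dist s t"
      using w by (auto simp: closed_segment_eq_real_ivl dist_real_def split: if_splits)
    have "d \<in> closed_segment (H s) (H w) \<or> c \<in> closed_segment (H w) (H t)"
      using out st by (auto simp: closed_segment_eq_real_ivl split: if_splits)
    then show False
    proof
      assume d: "d \<in> closed_segment (H s) (H w)"
      have sw: "closed_segment s w \<subseteq> closed_segment s t" using w by (simp add: subset_closed_segment)
      then obtain t' where t': "t' \<in> closed_segment s w" "H t' = d"
        using ivt_segment[OF continuous_on_subset[OF cont] d] sub by blast
      then have "(s, t') \<in> P c \<times> P d" using st sw sub by (auto simp: P_def)
      then have "dist s t \<le> dist s t'" using z(2) by (fastforce simp: s_def t_def)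
      also have "\<dots> \<le> dist s w" using t'
        by (auto simp: closed_segment_eq_real_ivl dist_real_def split: if_splits)
      finally show False using lt by simp
    next
      assume d: "c \<in> closed_segment (H w) (H t)"
      have sw: "closed_segment w t \<subseteq> closed_segment s t" using w by (simp add: subset_closed_segment)
      then obtain s' where t': "s' \<in> closed_segment w t" "H s' = c"
        using ivt_segment[OF continuous_on_subset[OF cont] d] sub by blast
      then have "(s', t) \<in> P c \<times> P d" using st sw sub by (auto simp: P_def)
      then have "dist s t \<le> dist s' t" using z(2) by (fastforce simp: s_def t_def)
      also have "\<dots> \<le> dist w t" using t'
        by (auto simp: closed_segment_eq_real_ivl dist_real_def split: if_splits)
      finally show False using lt by simp
    qed
  qed
  then show ?thesis using st by blast
qed

lemma funpow_maps: "(\<And>x. x \<in> S \<Longrightarrow> f x \<in> S) \<Longrightarrow> x \<in> S \<Longrightarrow> (f ^^ n) x \<in> S"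
  by (induction n) auto

lemma continuous_on_funpow:
  assumes "continuous_on S f" "\<And>x. x \<in> S \<Longrightarrow> f x \<in> S"
  shows "continuous_on S (f ^^ n)"
proof (induction n)
  case 0
  then show ?case by (simp add: id_def)
next
  case (Suc n)
  then show ?case
    unfolding funpow.simps using assms
    by (intro continuous_on_compose continuous_on_subset[OF assms(1)])
       (auto intro: funpow_maps[of S f])
qed

text \<open>
  Segments are given by their ends, in either order, and the image is only required to cover the
  next segment because of the images of the ends. Pulling back step by step yields a subsegment of
  the first segment which n steps map onto the last one, and onto means a fixed point.
\<close>

lemma segment_loop_shadowed:
  fixes f :: "real \<Rightarrow> real"
  assumes cont: "continuous_on S f" and maps: "\<And>x. x \<in> S \<Longrightarrow> f x \<in> S"
    and S: "closed_segment (e 0) (h 0) \<subseteq> S"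
    and cover: "\<And>i. closed_segment (e (Suc i)) (h (Suc i)) \<subseteq> closed_segment (f (e i)) (f (h i))"
    and loop: "e n = e 0" "h n = h 0"
  shows "\<exists>x. (f ^^ n) x = x \<and> (\<forall>i\<le>n. (f ^^ i) x \<in> closed_segment (e i) (h i))"
proof -
  have "\<exists>p q. p \<in> closed_segment (e 0) (h 0) \<and> q \<in> closed_segment (e 0) (h 0) \<and>
     (f ^^ m) p = e m \<and> (f ^^ m) q = h m \<and>
     (\<forall>i\<le>m. (f ^^ i) ` closed_segment p q \<subseteq> closed_segment (e i) (h i))" for m
  proof (induction m)
    case 0
    then show ?case by (intro exI[of _ "e 0"] exI[of _ "h 0"]) auto
  next
    case (Suc m)
    then obtain p q where pq: "p \<in> closed_segment (e 0) (h 0)" "q \<in> closed_segment (e 0) (h 0)"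
      "(f ^^ m) p = e m" "(f ^^ m) q = h m"
      "\<And>i. i \<le> m \<Longrightarrow> (f ^^ i) ` closed_segment p q \<subseteq> closed_segment (e i) (h i)" by blast
    have sub: "closed_segment p q \<subseteq> closed_segment (e 0) (h 0)"
      using pq by (simp add: subset_closed_segment)
    have "continuous_on (closed_segment p q) (f ^^ Suc m)"
      using continuous_on_funpow[OF cont maps] sub S by (blast intro: continuous_on_subset)
    moreover have "closed_segment (e (Suc m)) (h (Suc m))
        \<subseteq> closed_segment ((f ^^ Suc m) p) ((f ^^ Suc m) q)"
      using cover[of m] pq by simp
    ultimately obtain s t where st: "s \<in> closed_segment p q" "t \<in> closed_segment p q"
      "(f ^^ Suc m) s = e (Suc m)" "(f ^^ Suc m) t = h (Suc m)"
      "(f ^^ Suc m) ` closed_segment s t \<subseteq> closed_segment (e (Suc m)) (h (Suc m))"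
      using tight_subsegment[of p q "f ^^ Suc m"] by blast
    have sub': "closed_segment s t \<subseteq> closed_segment p q"
      using st by (simp add: subset_closed_segment)
    have "(f ^^ i) ` closed_segment s t \<subseteq> closed_segment (e i) (h i)" if "i \<le> Suc m" for i
      using that pq(5)[of i] st(5) sub' by (cases "i = Suc m") (auto simp del: funpow.simps)
    then show ?case using st sub by blast
  qed
  from this[of n] obtain p q where pq: "p \<in> closed_segment (e 0) (h 0)"
    "q \<in> closed_segment (e 0) (h 0)" "(f ^^ n) p = e 0" "(f ^^ n) q = h 0"
    "\<And>i. i \<le> n \<Longrightarrow> (f ^^ i) ` closed_segment p q \<subseteq> closed_segment (e i) (h i)"
    using loop by auto
  have sub: "closed_segment p q \<subseteq> closed_segment (e 0) (h 0)"
    using pq by (simp add: subset_closed_segment)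
  have "continuous_on (closed_segment p q) (\<lambda>x. (f ^^ n) x - x)"
    using continuous_on_funpow[OF cont maps] sub S
    by (intro continuous_intros) (blast intro: continuous_on_subset)
  moreover have "0 \<in> closed_segment ((f ^^ n) p - p) ((f ^^ n) q - q)"
    using pq(1-4) by (auto simp: closed_segment_eq_real_ivl split: if_splits)
  ultimately obtain x where "x \<in> closed_segment p q" "(f ^^ n) x - x = 0"
    using ivt_segment[of p q "\<lambda>x. (f ^^ n) x - x" 0] by blast
  then show ?thesis using pq(5) by (intro exI[of _ x]) auto
qed


section \<open>Over-rotation numbers of fold maps\<close>

lemma sum_add_index:
  fixes s :: "nat \<Rightarrow> real"
  shows "(\<Sum>i<m + n. s i) = (\<Sum>i<m. s i) + (\<Sum>i<n. s (m + i))"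
  by (induction n) auto

text \<open>
  Sums over a closed orbit do not depend on its starting point.
\<close>

lemma sum_shift_loop:
  fixes s :: "nat \<Rightarrow> real"
  assumes "s n = s 0"
  shows "(\<Sum>i<n. s (Suc i)) = (\<Sum>i<n. s i)"
  using sum.lessThan_Suc_shift[of s n] sum.lessThan_Suc[of s n] assms by simp

lemma funpow_mult_fixed: "(f ^^ n) x = x \<Longrightarrow> (f ^^ (n * m)) x = x"
  by (induction m) (auto simp: funpow_add)

text \<open>
  The topological part of the argument uses only this: 0 and a are fixed, points in (0, a) move to
  the right, points beyond a are sent to the left of a, and b is the left preimage of a.
\<close>

locale fold_map =
  fixes f :: "real \<Rightarrow> real" and a b :: real
  assumes maps: "x \<in> {0..1} \<Longrightarrow> f x \<in> {0..1}"
    and cont: "continuous_on {0..1} f"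
    and b_pos: "0 < b" and b_less: "b < a" and a_less: "a < 1"
    and f_0: "f 0 = 0" and f_a: "f a = a" and f_b: "f b = a"
    and above: "0 < x \<Longrightarrow> x < a \<Longrightarrow> x < f x"
    and right: "a < x \<Longrightarrow> x \<le> 1 \<Longrightarrow> f x < a"
    and below: "0 \<le> x \<Longrightarrow> x < b \<Longrightarrow> f x < a"
    and mid: "b < x \<Longrightarrow> x < a \<Longrightarrow> a < f x"
begin

lemma orbit_01: "y \<in> {0..1} \<Longrightarrow> (f ^^ i) y \<in> {0..1}"
  using funpow_maps[of "{0..1}" f] maps by blast

lemma orbit_avoids_fixed:
  assumes "(f ^^ q) y = y" "0 < q" "f y \<noteq> y" "f p = p"
  shows "(f ^^ i) y \<noteq> p"
proof
  assume i: "(f ^^ i) y = p"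
  have stay: "(f ^^ j) p = p" for j by (induction j) (auto simp: assms(4))
  have "q * i = (q * i - i) + i" using assms(2) by (simp add: le_add_diff_inverse2)
  then have "(f ^^ (q * i)) y = (f ^^ (q * i - i)) ((f ^^ i) y)"
    by (metis comp_apply funpow_add)
  then have "y = p" using funpow_mult_fixed[OF assms(1)] i stay by simp
  then show False using assms by simp
qed

text \<open>
  Off the fixed points the direction of motion changes at x exactly if one of x and f x lies
  beyond a (they cannot both do so). Hence \<open>over_rot_chi\<close> counts each visit to (a, 1] twice, with
  weight 1/2: on entering and on leaving.
\<close>

lemma chi_eq:
  assumes "x \<in> {0..1}" "x \<noteq> 0" "x \<noteq> a" "f x \<noteq> 0" "f x \<noteq> a"
  shows "over_rot_chi f x = (of_bool (a < x) + of_bool (a < f x)) / 2"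
proof (cases "a < x")
  case True
  then have "f x < a" "0 < f x" using right maps[of x] assms by auto
  then have "0 < f (f x) - f x" "f x - x < 0" using above True by auto
  then have "(f x - x) * (f (f x) - f x) \<le> 0" by (simp add: mult_le_0_iff)
  then show ?thesis using True \<open>f x < a\<close> by (simp add: over_rot_chi_def)
next
  case False
  then have x: "0 < x" "x < a" using assms by auto
  then have fx: "x < f x" using above by simp
  show ?thesis
  proof (cases "a < f x")
    case True
    then have "f (f x) < f x" using right[of "f x"] maps[of x] assms by auto
    then have "(f x - x) * (f (f x) - f x) \<le> 0" using fx by (simp add: mult_le_0_iff)
    then show ?thesis using True False by (simp add: over_rot_chi_def)
  next
    case nb: False
    then have "f x < f (f x)" using above[of "f x"] fx x assms by auto
    then have "0 < (f x - x) * (f (f x) - f x)" using fx by simp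
    then show ?thesis using nb False by (simp add: over_rot_chi_def)
  qed
qed

text \<open>
  The formula holds for any period q, not just for the least one. This matters when orbits of
  different maps are compared, because the periodic point found for f may have a smaller least
  period.
\<close>

lemma over_rotation_number_eq:
  assumes y: "y \<in> {0..1}" and q: "(f ^^ q) y = y" "0 < q" and nf: "f y \<noteq> y"
  shows "over_rotation_number f y = (\<Sum>i<q. of_bool (a < (f ^^ i) y)) / real q"
proof -
  define n where "n = period f y"
  define s where "s = (\<lambda>i. of_bool (a < (f ^^ i) y) :: real)"
  have "n > 0 \<and> (f ^^ n) y = y"
    unfolding n_def period_def by (rule LeastI[of _ q]) (use q in simp)
  then have n: "0 < n" "(f ^^ n) y = y" by auto
  have chi: "over_rot_chi f ((f ^^ i) y) = (s i + s (Suc i)) / 2" for i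
    using chi_eq[OF orbit_01[OF y], of i] orbit_avoids_fixed[OF q nf f_0]
      orbit_avoids_fixed[OF q nf f_a] orbit_avoids_fixed[OF q nf f_0, of "Suc i"]
      orbit_avoids_fixed[OF q nf f_a, of "Suc i"] by (simp add: s_def)
  have sn: "s n = s 0" using n by (simp add: s_def)
  have "(\<Sum>i<n. over_rot_chi f ((f ^^ i) y)) = ((\<Sum>i<n. s i) + (\<Sum>i<n. s (Suc i))) / 2"
    unfolding chi by (simp add: sum.distrib sum_divide_distrib[symmetric])
  also have "\<dots> = (\<Sum>i<n. s i)" using sum_shift_loop[OF sn] by simp
  finally have num: "over_rotation_number f y = (\<Sum>i<n. s i) / real n"
    by (simp add: over_rotation_number_def n_def)
  have "(f ^^ (q mod n)) y = y"
  proof -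
    have "q = q mod n + n * (q div n)" by simp
    then have "(f ^^ q) y = (f ^^ (q mod n)) ((f ^^ (n * (q div n))) y)"
      by (metis comp_apply funpow_add)
    then show ?thesis using q funpow_mult_fixed[OF n(2)] by simp
  qed
  then have "q mod n = 0"
    using not_less_Least[of "q mod n" "\<lambda>n. n > 0 \<and> (f ^^ n) y = y"] n
    unfolding n_def period_def by fastforce
  then obtain m where m: "q = n * m" by (auto simp: mod_eq_0_iff_dvd)
  have per: "s (n * k + i) = s i" for k i
    unfolding s_def using funpow_mult_fixed[OF n(2), of k]
    by (simp add: add.commute[of _ i] funpow_add)
  have "(\<Sum>i<n * k. s i) = real k * (\<Sum>i<n. s i)" for k
  proof (induction k)
    case (Suc k)
    have "(\<Sum>i<n * Suc k. s i) = (\<Sum>i<n * k. s i) + (\<Sum>i<n. s (n * k + i))"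
      using sum_add_index[of s "n * k" n] by (simp add: add.commute)
    then show ?case unfolding per Suc by (simp add: algebra_simps)
  qed simp
  then show ?thesis using num m q n by (simp add: s_def)
qed

text \<open>
  The largest point of the orbit to the left of a must jump over a, as otherwise it would move to a
  larger one.
\<close>

lemma rightmost_left_point:
  assumes y: "y \<in> {0..1}" and q: "(f ^^ q) y = y" "0 < q" and nf: "f y \<noteq> y"
  shows "\<exists>i. (f ^^ i) y < a \<and> a < f ((f ^^ i) y) \<and> (\<forall>k. (f ^^ k) y < a \<longrightarrow> (f ^^ k) y \<le> (f ^^ i) y)"
proof -
  define Y where "Y = (\<lambda>i. (f ^^ i) y)"
  have Y: "Y i \<in> {0..1}" "Y i \<noteq> 0" "Y i \<noteq> a" for i
    using orbit_01[OF y] orbit_avoids_fixed[OF q nf f_0] orbit_avoids_fixed[OF q nf f_a]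
    by (auto simp: Y_def)
  have YS: "Y (Suc i) = f (Y i)" for i by (simp add: Y_def)
  define P where "P = {x \<in> Y ` {..<q}. x < a}"
  have inP: "Y i \<in> P" if "Y i < a" for i
  proof -
    have "Y i = Y (i mod q)"
      unfolding Y_def using funpow_mult_fixed[OF q(1), of "i div q"]
      by (metis comp_apply funpow_add mod_mult_div_eq)
    then show ?thesis using that q by (auto simp: P_def)
  qed
  have "P \<noteq> {}"
  proof (cases "Y 0 < a")
    case True then show ?thesis using inP by blast
  next
    case False
    then have "Y 1 < a" using right[of "Y 0"] Y[of 0] YS[of 0] by auto
    then show ?thesis using inP by blast
  qed
  moreover have "finite P" by (simp add: P_def)
  ultimately have max: "Max P \<in> P" "\<And>x. x \<in> P \<Longrightarrow> x \<le> Max P" by auto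
  then obtain i where i: "Max P = Y i" "Y i < a" by (auto simp: P_def)
  have pos: "0 < Y i" using Y[of i] by auto
  have "\<not> f (Y i) < a"
    using max(2) inP[of "Suc i"] above[OF pos i(2)] i YS by fastforce
  then have "a < f (Y i)" using Y[of "Suc i"] YS by auto
  moreover have "\<forall>k. Y k < a \<longrightarrow> Y k \<le> Y i" using max(2) inP i by auto
  ultimately show ?thesis using i unfolding Y_def by blast
qed

lemma over_rotation_number_orbit:
  assumes y: "y \<in> {0..1}" and q: "(f ^^ q) y = y" "0 < q" and nf: "f y \<noteq> y"
  shows "over_rotation_number f ((f ^^ k) y) = over_rotation_number f y"
proof (induction k)
  case (Suc k)
  define x where "x = (f ^^ k) y"
  have x: "x \<in> {0..1}" "(f ^^ q) x = x"
    using orbit_01[OF y] q by (auto simp: x_def) (metis comp_apply funpow_add add.commute)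
  have nfx: "f x \<noteq> x"
    using orbit_avoids_fixed[OF q nf, of x k] by (auto simp: x_def)
  have fx: "f x \<in> {0..1}" "(f ^^ q) (f x) = f x"
    using maps x by (auto simp: funpow_swap1[symmetric])
  have nffx: "f (f x) \<noteq> f x"
    using orbit_avoids_fixed[OF x(2) q(2) nfx, of "f x" "Suc 0"] by auto
  have "over_rotation_number f (f x) = over_rotation_number f x"
    unfolding over_rotation_number_eq[OF fx q(2) nffx] over_rotation_number_eq[OF x q(2) nfx]
    using sum_shift_loop[of "\<lambda>i. of_bool (a < (f ^^ i) x)" q] x
    by (simp add: funpow_swap1)
  then show ?case using Suc by (simp add: x_def)
qed simp

text \<open>
  The largest point of the orbit to the left of a returns after two steps to itself or below, whereas
  the left preimage b of a is sent above itself. In between there is a fixed point of the second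
  iterate, and it jumps over a.
\<close>

lemma period_two:
  assumes y: "y \<in> {0..1}" and q: "(f ^^ q) y = y" "0 < q" and nf: "f y \<noteq> y"
  shows "\<exists>p\<in>{0..1}. f (f p) = p \<and> f p \<noteq> p"
proof -
  define Y where "Y = (\<lambda>i. (f ^^ i) y)"
  have Y: "Y i \<in> {0..1}" "Y i \<noteq> 0" for i
    using orbit_01[OF y] orbit_avoids_fixed[OF q nf f_0] by (auto simp: Y_def)
  have YS: "Y (Suc i) = f (Y i)" for i by (simp add: Y_def)
  obtain i where i: "Y i < a" "a < f (Y i)" "\<And>k. Y k < a \<Longrightarrow> Y k \<le> Y i"
    using rightmost_left_point[OF y q nf] unfolding Y_def by blast
  have pos: "0 < Y i" using Y[of i] by auto
  have "f (f (Y i)) < a" using right[of "f (Y i)"] i Y(1)[of "Suc i"] YS by simp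
  then have le: "f (f (Y i)) \<le> Y i" using i(3)[of "Suc (Suc i)"] YS by simp
  have bY: "b \<le> Y i" using below[of "Y i"] i pos by force
  have "continuous_on {b..Y i} (\<lambda>x. f (f x) - x)"
  proof -
    have "continuous_on {0..1} (f \<circ> f)"
      using maps cont by (intro continuous_on_compose continuous_on_subset[OF cont]) auto
    then have "continuous_on {b..Y i} (f \<circ> f)"
      by (rule continuous_on_subset) (use b_pos Y[of i] in auto)
    then show ?thesis by (intro continuous_intros) (simp add: comp_def)
  qed
  then obtain p where p: "b \<le> p" "p \<le> Y i" "f (f p) - p = 0"
    using IVT2'[of "\<lambda>x. f (f x) - x" "Y i" 0 b] le f_a f_b b_less bY by auto
  have "p \<noteq> b" using p f_a f_b b_less by auto
  then have "a < f p" using mid p i by simp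
  then show ?thesis using p i b_pos Y[of i] by (intro bexI[of _ p]) auto
qed

end

text \<open>
  X p is a point to the right of p with the same image under g; the comparison of f with g is
  available only from such points. The last assumption is the comparison until the next jump.
\<close>

lemma transfer_orbit:
  assumes F: "fold_map f af bf" and G: "fold_map g ag bg" and aa: "ag \<le> af"
    and ge: "\<And>x. x \<in> {0..1} \<Longrightarrow> g x \<le> f x"
    and y: "y \<in> {0..1}" "(g ^^ n) y = y" "g y \<noteq> y" and y0: "y < ag" "ag < g y"
    and low: "j0 < n" "(g ^^ j0) y < ag" "(g ^^ Suc j0) y < ag"
    and X: "\<And>p. 0 < p \<Longrightarrow> p < ag \<Longrightarrow> ag < g p \<Longrightarrow> p \<le> X p \<and> X p < ag \<and> g (X p) = g p"
    and comp: "\<And>p k. 0 < p \<Longrightarrow> p < ag \<Longrightarrow> ag < g p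
      \<Longrightarrow> (\<And>j. j < k \<Longrightarrow> (g ^^ j) (g (g p)) < ag \<and> (g ^^ Suc j) (g (g p)) < ag)
      \<Longrightarrow> (f ^^ k) (f (f (X p))) \<le> (g ^^ k) (g (g p))"
  shows "\<exists>x\<in>{0..1}. (f ^^ n) x = x \<and> f x \<noteq> x \<and> (\<forall>i<n. af < (f ^^ i) x \<longleftrightarrow> ag < (g ^^ i) y)"
proof -
  interpret f: fold_map f af bf by fact
  interpret g: fold_map g ag bg by fact
  have n: "0 < n" using low by simp
  define Y where "Y = (\<lambda>i. (g ^^ i) y)"
  have Y: "0 < Y i" "Y i \<le> 1" "Y i \<noteq> ag" for i
    using g.orbit_01[OF y(1), of i] g.orbit_avoids_fixed[OF y(2) n y(3) g.f_0, of i]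
      g.orbit_avoids_fixed[OF y(2) n y(3) g.f_a, of i] by (auto simp: Y_def)
  have YS: "Y (Suc i) = g (Y i)" for i by (simp add: Y_def)
  have Y2: "(g ^^ j) (g (g (Y m))) = Y (m + 2 + j)" for m j
    by (induction j) (simp_all add: YS)
  have Yn: "Y n = Y 0" using y by (simp add: Y_def)
  define ex where "ex = (\<lambda>i. Y i < ag \<and> ag < Y (Suc i))"
  define lo where "lo = (\<lambda>i. Y i < ag \<and> Y (Suc i) < ag)"
  have tri: "Y i < ag \<Longrightarrow> \<not> ex i \<Longrightarrow> lo i" for i
    using Y(3)[of "Suc i"] by (auto simp: ex_def lo_def)
  have rt: "Y (Suc i) < ag" if "ag < Y i" for i using g.right[OF that] Y[of i] YS by simp
  \<comment> \<open>The point e i follows f, but it restarts at X (Y i) whenever Y i jumps over the fixed point of g.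
        Together with h i it spans the i-th segment of the loop.\<close>
  define e where "e = rec_nat (X (Y 0)) (\<lambda>i r. if ex (Suc i) then X (Y (Suc i)) else f r)"
  have e_0: "e 0 = X (Y 0)" by (simp add: e_def)
  have e_ex: "ex (Suc i) \<Longrightarrow> e (Suc i) = X (Y (Suc i))" for i by (simp add: e_def)
  have e_nex: "\<not> ex (Suc i) \<Longrightarrow> e (Suc i) = f (e i)" for i by (simp add: e_def)
  define h where "h = (\<lambda>i. if lo i then bf else af)"
  have ex0: "ex 0" using y0 by (simp add: ex_def Y_def)
  have X': "Y m \<le> X (Y m)" "X (Y m) < ag" "g (X (Y m)) = Y (Suc m)" if "ex m" for m
    using X[of "Y m"] Y[of m] that YS by (auto simp: ex_def)
  have X01: "X (Y m) \<in> {0..1}" "0 < X (Y m)" if "ex m" for m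
    using X'[OF that] Y[of m] g.a_less by auto
  have comp': "(f ^^ k) (f (f (X (Y m)))) \<le> Y (m + 2 + k)"
    if "ex m" "\<And>j. j < k \<Longrightarrow> lo (m + 2 + j)" for m k
    using comp[of "Y m" k] that Y[of m] unfolding ex_def lo_def Y2
    by (simp add: Y2 YS[symmetric] del: funpow.simps)
  \<comment> \<open>Position of the time i relative to the last jump m: at it, one step after it (beyond the fixed
        point), or later (climbing).\<close>
  have dec: "\<exists>m. ex m \<and> (i = m \<and> e i = X (Y m) \<or> i = Suc m \<and> e i = f (X (Y m)) \<or>
      (\<exists>k. i = m + 2 + k \<and> e i = (f ^^ k) (f (f (X (Y m)))) \<and> (\<forall>j\<le>k. lo (m + 2 + j))))" for i
  proof (induction i)
    case 0
    then show ?case using ex0 e_0 by blast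
  next
    case (Suc i)
    show ?case
    proof (cases "ex (Suc i)")
      case True
      then show ?thesis using e_ex by blast
    next
      case False
      note e = e_nex[OF False]
      from Suc obtain m where m: "ex m" and
        "i = m \<and> e i = X (Y m) \<or> i = Suc m \<and> e i = f (X (Y m)) \<or>
        (\<exists>k. i = m + 2 + k \<and> e i = (f ^^ k) (f (f (X (Y m)))) \<and> (\<forall>j\<le>k. lo (m + 2 + j)))" by blast
      then consider "i = m" "e i = X (Y m)" | "i = Suc m" "e i = f (X (Y m))"
        | k where "i = m + 2 + k" "e i = (f ^^ k) (f (f (X (Y m))))" "\<And>j. j \<le> k \<Longrightarrow> lo (m + 2 + j)"
        by blast
      then show ?thesis
      proof cases
        case 1
        then show ?thesis using m e by auto
      next
        case 2
        have "lo (m + 2 + 0)" using tri[OF rt[of "Suc m"] ] m 2 False by (auto simp: ex_def)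
        then show ?thesis using m e 2 by (intro exI[of _ m] conjI disjI2 exI[of _ 0]) auto
      next
        case 3
        have "lo (Suc i)" using tri[OF _ False] 3(1) 3(3)[of k] by (auto simp: lo_def)
        then have "lo (m + 2 + j)" if "j \<le> Suc k" for j
          using 3(1) 3(3)[of j] that by (cases "j = Suc k") auto
        then show ?thesis using m e 3 by (intro exI[of _ m] conjI disjI2 exI[of _ "Suc k"]) auto
      qed
    qed
  qed
  have e01: "e i \<in> {0..1}" for i
    using dec[of i] X01 f.maps funpow_maps[of "{0..1}" f] by (metis (no_types, lifting))
  have e_exit: "e i = X (Y i)" if "ex i" for i
    using that e_0 e_ex by (cases i) auto
  have step_le: "f (e i) \<le> Y (Suc i)" if "\<not> ex i" for i
  proof -
    from dec[of i] that obtain m where m: "ex m" and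
      "i = Suc m \<and> e i = f (X (Y m)) \<or>
        (\<exists>k. i = m + 2 + k \<and> e i = (f ^^ k) (f (f (X (Y m)))) \<and> (\<forall>j\<le>k. lo (m + 2 + j)))" by blast
    then consider "i = Suc m" "e i = f (X (Y m))"
      | k where "i = m + 2 + k" "e i = (f ^^ k) (f (f (X (Y m))))" "\<And>j. j \<le> k \<Longrightarrow> lo (m + 2 + j)"
      by blast
    then show ?thesis
    proof cases
      case 1
      then show ?thesis using comp'[OF m, of 0] by simp
    next
      case 2
      have "(f ^^ Suc k) (f (f (X (Y m)))) \<le> Y (m + 2 + Suc k)"
        using 2(3) by (intro comp'[OF m]) auto
      then show ?thesis using 2 by simp
    qed
  qed
  \<comment> \<open>If e i had passed the left preimage bf, it would jump over af now, ahead of the orbit of g.\<close>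
  have lo_le: "e i \<le> bf" if "lo i" for i
  proof (rule ccontr)
    assume "\<not> e i \<le> bf"
    moreover have nex: "\<not> ex i" using that by (auto simp: ex_def lo_def)
    moreover have "e i \<le> Y i"
    proof -
      from dec[of i] nex that have "\<exists>m k. ex m \<and> i = m + 2 + k \<and>
          e i = (f ^^ k) (f (f (X (Y m)))) \<and> (\<forall>j\<le>k. lo (m + 2 + j))"
        by (auto simp: ex_def lo_def)
      then show ?thesis using comp' by (metis less_imp_le_nat)
    qed
    ultimately have "af < f (e i)" using that aa by (intro f.mid) (auto simp: lo_def)
    then show False using step_le[OF nex] that aa by (auto simp: lo_def)
  qed
  \<comment> \<open>If f failed to jump over its fixed point af, then the next point would still be larger than its
        predecessor, which exceeds ag, against the comparison.\<close>
  have right_ge: "af \<le> e i" if "ag < Y i" for i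
  proof (rule ccontr)
    assume neg: "\<not> af \<le> e i"
    have "\<not> ex i" "\<not> lo i" using that by (auto simp: ex_def lo_def)
    with dec[of i] obtain m where m: "ex m" "i = Suc m" "e i = f (X (Y m))"
      by fastforce
    have "X (Y m) < f (X (Y m))" using X01[OF m(1)] X'[OF m(1)] aa by (intro f.above) auto
    then have "f (X (Y m)) < f (f (X (Y m)))"
      using X01[OF m(1)] neg m by (intro f.above) auto
    moreover have "ag < f (X (Y m))"
      using ge[of "X (Y m)"] X01[OF m(1)] X'[OF m(1)] that m by simp
    moreover have "f (f (X (Y m))) \<le> Y (m + 2)" using comp'[OF m(1), of 0] by simp
    moreover have "Y (m + 2) < ag" using rt[OF that] m by simp
    ultimately show False by simp
  qed
  have fh: "f (h i) = af" for i using f.f_a f.f_b by (simp add: h_def)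
  have cover: "closed_segment (e (Suc i)) (h (Suc i)) \<subseteq> closed_segment (f (e i)) (f (h i))" for i
  proof -
    consider "ag < Y (Suc i)" | "ex (Suc i)" | "lo (Suc i)" using tri Y(3)[of "Suc i"] by force
    then show ?thesis
    proof cases
      case 1
      then have "e (Suc i) = f (e i)" "h (Suc i) = af"
        using e_nex[of i] by (auto simp: ex_def h_def lo_def)
      then show ?thesis unfolding fh by simp
    next
      case 2
      have "\<not> ex i" using 2 by (auto simp: ex_def)
      then have "f (e i) \<le> e (Suc i)" "e (Suc i) \<le> af"
        using step_le[of i] X'[OF 2] e_ex[OF 2] aa by auto
      moreover have "h (Suc i) = af" using 2 by (auto simp: h_def ex_def lo_def)
      ultimately show ?thesis unfolding fh by (auto simp: closed_segment_eq_real_ivl)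
    next
      case 3
      then have "e (Suc i) = f (e i)" using e_nex[of i] by (auto simp: ex_def lo_def)
      then show ?thesis using lo_le[OF 3] f.b_less 3 unfolding fh
        by (auto simp: h_def closed_segment_eq_real_ivl)
    qed
  qed
  have e0: "e 0 < af" "0 < e 0" using X'[OF ex0] X01[OF ex0] aa e_0 by auto
  have h0: "h 0 = af" using ex0 by (auto simp: h_def ex_def lo_def)
  have loop: "e n = e 0" "h n = h 0"
  proof -
    have Yn': "Y (Suc n) = Y (Suc 0)" using Yn YS by simp
    then show "h n = h 0" using Yn by (simp add: h_def lo_def)
    have "ex n" using ex0 Yn Yn' by (simp add: ex_def)
    then show "e n = e 0" using e_exit e_0 Yn by simp
  qed
  have "closed_segment (e 0) (h 0) \<subseteq> {0..1}"
    using e0 h0 f.a_less by (auto simp: closed_segment_eq_real_ivl)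
  from segment_loop_shadowed[OF f.cont f.maps this cover loop]
  obtain x where x: "(f ^^ n) x = x" "\<And>i. i \<le> n \<Longrightarrow> (f ^^ i) x \<in> closed_segment (e i) (h i)" by blast
  have x0: "e 0 \<le> x" "x \<le> af" using x(2)[of 0] e0 h0 by (auto simp: closed_segment_eq_real_ivl)
  have xlo: "(f ^^ i) x \<le> bf" if "lo i" "i \<le> n" for i
    using x(2)[OF that(2)] lo_le[OF that(1)] that by (auto simp: h_def closed_segment_eq_real_ivl)
  have lj: "lo j0" using low by (simp add: lo_def Y_def)
  \<comment> \<open>A fixed point would lie in the segment of a climbing time, hence strictly between 0 and af,
      where all points move to the right.\<close>
  have nf: "f x \<noteq> x"
  proof
    assume fx: "f x = x"
    then have "(f ^^ j0) x = x" by (induction j0) auto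
    then have "x \<le> bf" using xlo[OF lj] low by simp
    then have "x < f x" using x0 e0 f.b_less by (intro f.above) auto
    then show False using fx by simp
  qed
  have off: "(f ^^ i) x \<noteq> af" for i by (rule f.orbit_avoids_fixed[OF x(1) n nf f.f_a])
  have "af < (f ^^ i) x \<longleftrightarrow> ag < Y i" if "i < n" for i
  proof -
    have s: "(f ^^ i) x \<in> closed_segment (e i) (h i)" using x(2) that by simp
    consider "ag < Y i" | "ex i" | "lo i" using tri Y(3)[of i] by force
    then show ?thesis
    proof cases
      case 1
      then have "af \<le> (f ^^ i) x"
        using s right_ge[OF 1] by (auto simp: h_def lo_def closed_segment_eq_real_ivl split: if_splits)
      then show ?thesis using off[of i] 1 by simp
    next
      case 2
      then have "(f ^^ i) x \<le> af" using s e_exit[OF 2] X'[OF 2] aa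
        by (auto simp: h_def lo_def ex_def closed_segment_eq_real_ivl split: if_splits)
      then show ?thesis using 2 by (simp add: ex_def)
    next
      case 3
      then show ?thesis using xlo[OF 3] that f.b_less by (simp add: lo_def)
    qed
  qed
  moreover have "x \<in> {0..1}" using x0 e0 f.a_less by auto
  ultimately show ?thesis using x(1) nf by (auto simp: Y_def)
qed


section \<open>Polynomial maps and the inclusion of over-rotation intervals\<close>

lemma linear_le_at_ends:
  fixes p q :: real
  assumes "\<And>x. 0 < x \<Longrightarrow> x < 1 \<Longrightarrow> p + q * x \<le> 0"
  shows "p \<le> 0" "p + q \<le> 0"
proof -
  have "closed {x. p + q * x \<le> 0}" by (intro closed_Collect_le continuous_intros)
  then have "closure {0<..<1} \<subseteq> {x. p + q * x \<le> 0}"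
    using assms by (intro closure_minimal) auto
  then have "{0..1} \<subseteq> {x. p + q * x \<le> 0}" by simp
  then show "p \<le> 0" "p + q \<le> 0" by (auto dest: subsetD[of _ _ 0] subsetD[of _ _ 1])
qed

text \<open>
  Division by x (1 - x) leaves an inequality of linear functions on (0, 1), whose values at the ends
  are the coefficients.
\<close>

lemma coeffs_le_if_cub_le:
  assumes "\<And>x. x \<in> {0..1} \<Longrightarrow> cub A B x \<le> cub A2 B2 x"
  shows "A \<le> A2" "B \<le> B2"
proof -
  have "(A - A2) + ((B - B2) - (A - A2)) * x \<le> 0" if "0 < x" "x < 1" for x
  proof -
    have "x * (1 - x) * ((A - A2) + ((B - B2) - (A - A2)) * x) \<le> 0"
      using assms[of x] that by (simp add: cub_def algebra_simps)
    then show ?thesis using that by (auto simp: mult_le_0_iff)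
  qed
  from linear_le_at_ends[OF this] show "A \<le> A2" "B \<le> B2" by auto
qed

text \<open>
  The symmetric second difference of a cubic is exactly its second derivative up to the factor h^2,
  so concavity is an inequality of linear functions on (0, 1).
\<close>

lemma cub_concave_coeffs:
  assumes conc: "concave_on {0..1} f" and f: "\<And>x. x \<in> {0..1} \<Longrightarrow> f x = cub A B x"
  shows "A \<le> 2 * B" "B \<le> 2 * A"
proof -
  have "(B - 2 * A) + 3 * (A - B) * x \<le> 0" if x: "0 < x" "x < 1" for x
  proof -
    define h where "h = min x (1 - x)"
    have h: "0 < h" "x - h \<in> {0..1}" "x + h \<in> {0..1}" using x by (auto simp: h_def)
    have "(1 - 1/2) * f (x - h) + 1/2 * f (x + h) \<le> f ((1 - 1/2) *\<^sub>R (x - h) + (1/2) *\<^sub>R (x + h))"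
      using h by (intro concave_onD[OF conc]) auto
    also have "(1 - 1/2) *\<^sub>R (x - h) + (1/2) *\<^sub>R (x + h) = x" by (simp add: field_simps)
    finally have "cub A B (x - h) + cub A B (x + h) - 2 * cub A B x \<le> 0"
      using f h x by simp
    also have "cub A B (x - h) + cub A B (x + h) - 2 * cub A B x
        = 2 * h\<^sup>2 * ((B - 2 * A) + 3 * (A - B) * x)"
      unfolding cub_def by algebra
    finally show ?thesis using h by (simp add: mult_le_0_iff)
  qed
  from linear_le_at_ends[OF this] show "A \<le> 2 * B" "B \<le> 2 * A" by auto
qed

text \<open>
  The fixed point comes from the intermediate value theorem between the turning point c, where
  f c > c, and 1. Its slope is negative because c is a maximum to its left and f is strictly
  concave.
\<close>

lemma class_G_cub:
  assumes "f \<in> class_G"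
  obtains A B a where "concave_cubic A B a" "\<And>x. x \<in> {0..1} \<Longrightarrow> f x = cub A B x"
    "\<And>x. x \<in> {0..1} \<Longrightarrow> cub A B x \<in> {0..1}"
proof -
  obtain p where p: "degree p \<le> 3" "\<And>x. x \<in> {0..1} \<Longrightarrow> f x = poly p x"
    using assms by (auto simp: class_G_def)
  have S: "f \<in> class_S" using assms by (simp add: class_G_def)
  then obtain c where tp: "turning_point f c" and c3: "\<forall>x\<in>{0..1}. f x \<le> f c" and c4: "f c > c"
    unfolding class_S_def by blast
  have c: "0 < c" "c < 1" "\<And>x. x \<in> {0..1} \<Longrightarrow> f x \<le> f c" "c < f c"
    using tp c3 c4 by (simp_all add: turning_point_def)
  have S': "f ` {0..1} \<subseteq> {0..1}" "concave_on {0..1} f" "f 0 = 0" "f 1 = 0"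
    using S unfolding class_S_def by blast+
  then have f01: "f 0 = 0" "f 1 = 0" "\<And>x. x \<in> {0..1} \<Longrightarrow> f x \<in> {0..1}" and conc: "concave_on {0..1} f"
    by blast+
  define k where "k = coeff p"
  have pk: "poly p x = k 0 + k 1 * x + k 2 * x\<^sup>2 + k 3 * x ^ 3" for x
  proof -
    have "poly p x = (\<Sum>i\<le>3. coeff p i * x ^ i)"
      unfolding poly_altdef using p(1)
      by (intro sum.mono_neutral_left) (auto intro: coeff_eq_0)
    then show ?thesis by (simp add: k_def numeral_eq_Suc)
  qed
  have k0: "k 0 = 0" using p(2)[of 0] f01 pk[of 0] by simp
  have k1: "k 2 = - k 1 - k 3" using p(2)[of 1] f01 pk[of 1] k0 by simp
  define A B where "A = k 1" and "B = k 1 - k 3"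
  have fc: "f x = cub A B x" if "x \<in> {0..1}" for x
  proof -
    have "f x = k 1 * x + (- k 1 - k 3) * x\<^sup>2 + k 3 * x ^ 3"
      using p(2)[OF that] pk[of x] k0 k1 by simp
    also have "\<dots> = cub A B x" unfolding cub_def A_def B_def by algebra
    finally show ?thesis .
  qed
  note AB = cub_concave_coeffs[OF conc fc]
  have A_pos: "0 < A"
  proof (rule ccontr)
    assume "\<not> 0 < A"
    then have "A = 0" "B = 0" using AB by auto
    then show False using fc[of c] c by (simp add: cub_def)
  qed
  have "continuous_on {c..1} (\<lambda>x. cub A B x - x)" by (intro continuous_intros)
  then obtain a where a: "c \<le> a" "a \<le> 1" "cub A B a = a"
    using IVT2'[of "\<lambda>x. cub A B x - x" 1 0 c] c fc[of c] by auto
  then have ac: "c < a" "a < 1" using c fc[of c] by (auto simp: order_less_le)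
  have br: "0 < 2 * A - B + (B - A) * (c + 2 * a)"
    using A_pos AB c ac by (intro bracket_pos) auto
  have slope: "dcub A B a < 0"
  proof (rule ccontr)
    assume "\<not> dcub A B a < 0"
    then have "dcub A B a * (c - a) \<le> 0" using ac by (simp add: mult_nonneg_nonpos)
    moreover have "0 < (c - a)\<^sup>2 * (2 * A - B + (B - A) * (c + 2 * a))" using br ac by simp
    moreover have "a \<le> cub A B c" using c(3)[of a] fc[of a] fc[of c] c ac a by simp
    ultimately show False using cub_taylor[of A B c a] a(3) by linarith
  qed
  have "cub A B (1/2) \<le> 1" using fc[of "1/2"] f01(3)[of "1/2"] by simp
  then have "A + B \<le> 8" by (simp add: cub_def field_simps)
  then have "concave_cubic A B a"
    using A_pos AB ac c a slope by unfold_locales auto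
  then show ?thesis using that fc f01(3) by metis
qed

lemma (in concave_cubic) fold_map:
  assumes "\<And>x. x \<in> {0..1} \<Longrightarrow> g x \<in> {0..1}"
  shows "fold_map g a pre"
proof
  show "continuous_on {0..1} g" by (intro continuous_intros)
qed (use assms pre a_less fix_a g_pre above_diag right_below below_pre above_pre in auto)

text \<open>
  The maps are functions on the whole line, but only their values on S matter.
\<close>

lemma over_rotation_interval_cong:
  assumes f: "\<And>x. x \<in> S \<Longrightarrow> f x = f' x" and maps: "\<And>x. x \<in> S \<Longrightarrow> f' x \<in> S"
  shows "nonfixed_periodic_points S f = nonfixed_periodic_points S f'"
    and "over_rotation_interval S f = over_rotation_interval S f'"
proof -
  have iter: "(f ^^ n) x = (f' ^^ n) x" if "x \<in> S" for n x
    using that funpow_maps[of S f' x, OF maps] f by (induction n) auto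
  show np: "nonfixed_periodic_points S f = nonfixed_periodic_points S f'"
    unfolding nonfixed_periodic_points_def is_periodic_def using iter f by auto
  have "over_rotation_number f y = over_rotation_number f' y" if y: "y \<in> S" for y
  proof -
    have "over_rot_chi f ((f ^^ i) y) = over_rot_chi f' ((f' ^^ i) y)" for i
      using iter[OF y] f maps funpow_maps[of S f' y i, OF maps y] by (simp add: over_rot_chi_def)
    moreover have "period f y = period f' y" unfolding period_def using iter[OF y] by simp
    ultimately show ?thesis by (simp add: over_rotation_number_def)
  qed
  then have "over_rotation_number f ` nonfixed_periodic_points S f
      = over_rotation_number f' ` nonfixed_periodic_points S f'"
    unfolding np by (intro image_cong) (auto simp: nonfixed_periodic_points_def)
  then show "over_rotation_interval S f = over_rotation_interval S f'"
    by (simp add: over_rotation_interval_def)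
qed

lemma (in fold_map) over_rotation_half:
  assumes y: "y \<in> {0..1}" and q: "(f ^^ q) y = y" "0 < q" and nf: "f y \<noteq> y"
    and alt: "\<And>i. (f ^^ i) y < a \<Longrightarrow> a < (f ^^ Suc i) y"
  shows "over_rotation_number f y = 1/2"
proof -
  define s where "s = (\<lambda>i. of_bool (a < (f ^^ i) y) :: real)"
  have "s i + s (Suc i) = 1" for i
  proof (cases "(f ^^ i) y < a")
    case True then show ?thesis using alt by (simp add: s_def)
  next
    case False
    then have "a < (f ^^ i) y" using orbit_avoids_fixed[OF q nf f_a, of i] by simp
    then show ?thesis using right[of "(f ^^ i) y"] orbit_01[OF y, of i] by (simp add: s_def)
  qed
  then have "(\<Sum>i<q. s i) + (\<Sum>i<q. s (Suc i)) = real q"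
    by (simp add: sum.distrib[symmetric])
  moreover have "(\<Sum>i<q. s (Suc i)) = (\<Sum>i<q. s i)"
    by (rule sum_shift_loop) (use q in \<open>simp add: s_def\<close>)
  ultimately have "(\<Sum>i<q. s i) = real q / 2" by simp
  then show ?thesis using over_rotation_number_eq[OF y q nf] q by (simp add: s_def)
qed

lemma (in fold_map) half_attained:
  assumes "nonfixed_periodic_points {0..1} f \<noteq> {}"
  shows "1/2 \<in> over_rotation_number f ` nonfixed_periodic_points {0..1} f"
proof -
  obtain y q where "y \<in> {0..1}" "(f ^^ q) y = y" "0 < q" "f y \<noteq> y"
    using assms by (auto simp: nonfixed_periodic_points_def is_periodic_def)
  from period_two[OF this] obtain p where p: "p \<in> {0..1}" "f (f p) = p" "f p \<noteq> p" by blast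
  have p2: "(f ^^ 2) p = p" using p by (simp add: numeral_2_eq_2)
  have "over_rotation_number f p = 1/2"
  proof (rule over_rotation_half[OF p(1) p2 _ p(3)])
    fix i assume lt: "(f ^^ i) p < a"
    have "(f ^^ i) p \<noteq> 0" by (rule orbit_avoids_fixed[OF p2 _ p(3) f_0]) simp
    then have pos: "0 < (f ^^ i) p" using orbit_01[OF p(1), of i] by simp
    have off: "(f ^^ Suc i) p \<noteq> a" by (rule orbit_avoids_fixed[OF p2 _ p(3) f_a]) simp
    have two: "f (f ((f ^^ i) p)) = (f ^^ i) p"
      using p(2) by (metis funpow_swap1)
    show "a < (f ^^ Suc i) p"
    proof (rule ccontr)
      assume "\<not> ?thesis"
      then have "f ((f ^^ i) p) < a" using off by simp
      then show False
        using above[OF pos lt] above[of "f ((f ^^ i) p)"] pos two by simp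
    qed
  qed simp
  moreover have "p \<in> nonfixed_periodic_points {0..1} f"
    using p p2 by (auto simp: nonfixed_periodic_points_def is_periodic_def intro!: exI[of _ 2])
  ultimately show ?thesis by (metis image_eqI)
qed

text \<open>
  An orbit that starts with a jump over a and is left of a at two consecutive times must at some
  time jump and land so low that it has to climb: otherwise jumps and visits beyond a would
  alternate forever.
\<close>

lemma (in fold_map) low_after_exit:
  assumes y: "y \<in> {0..1}" and q: "(f ^^ q) y = y" "0 < q" and nf: "f y \<noteq> y"
    and y0: "y < a" "a < f y" and low: "(f ^^ j) y < a" "(f ^^ Suc j) y < a"
  shows "\<exists>m. (f ^^ m) y < a \<and> a < (f ^^ Suc m) y
    \<and> (f ^^ (m + 2)) y < a \<and> (f ^^ (m + 3)) y < a"
proof (rule ccontr)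
  assume no: "\<not> ?thesis"
  define Y where "Y = (\<lambda>i. (f ^^ i) y)"
  have Y: "Y i \<in> {0..1}" "Y i \<noteq> a" for i
    using orbit_01[OF y] orbit_avoids_fixed[OF q nf f_a] by (auto simp: Y_def)
  have rt: "Y (Suc i) < a" if "a < Y i" for i using right[OF that] Y[of i] by (simp add: Y_def)
  have no': "\<not> (Y m < a \<and> a < Y (Suc m) \<and> Y (m + 2) < a \<and> Y (m + 3) < a)" for m
    using no unfolding Y_def by blast
  have "(Y i < a \<and> a < Y (Suc i)) \<or> (\<exists>m. i = Suc m \<and> Y m < a \<and> a < Y i)" for i
  proof (induction i)
    case 0
    then show ?case using y0 by (simp add: Y_def)
  next
    case (Suc i)
    then show ?case
    proof
      assume "Y i < a \<and> a < Y (Suc i)" then show ?thesis by blast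
    next
      assume "\<exists>m. i = Suc m \<and> Y m < a \<and> a < Y i"
      then obtain m where m: "i = Suc m" "Y m < a" "a < Y i" by blast
      have "Y (Suc i) < a" using rt m by blast
      moreover have "Y (Suc (Suc i)) \<noteq> a" using Y by blast
      ultimately show ?thesis using no'[of m] m by (auto simp: numeral_3_eq_3)
    qed
  qed
  from this[of j] low show False by (auto simp: Y_def)
qed

lemma orbit_wrap:
  assumes "(f ^^ n) y = y" "0 < n"
  shows "\<exists>j<n. (f ^^ j) ((f ^^ i) y) = (f ^^ k) y"
proof -
  define t where "t = k + (n * i - i)"
  have "i \<le> n * i" using assms(2) by (cases n) auto
  then have "t + i = k + n * i" unfolding t_def by linarith
  then have "(f ^^ t) ((f ^^ i) y) = (f ^^ k) ((f ^^ (n * i)) y)"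
    by (metis comp_apply funpow_add)
  then have 1: "(f ^^ t) ((f ^^ i) y) = (f ^^ k) y" using funpow_mult_fixed[OF assms(1)] by simp
  define x where "x = (f ^^ i) y"
  have x: "(f ^^ n) x = x" unfolding x_def by (metis add.commute assms(1) comp_apply funpow_add)
  then have "(f ^^ (t mod n)) x = (f ^^ t) x"
    using funpow_mult_fixed[OF x, of "t div n"] by (metis comp_apply funpow_add mod_mult_div_eq)
  then show ?thesis using 1 assms(2) by (intro exI[of _ "t mod n"]) (auto simp: x_def)
qed

text \<open>
  The orbit of g either alternates between the sides of its fixed point or makes g steep; in the
  second case the comparison and the transfer apply after the orbit has been shifted to start with
  a jump.
\<close>

lemma cubic_over_rotation_subset:
  assumes g: "concave_cubic A B a" and f: "concave_cubic A2 B2 a2"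
    and le: "A \<le> A2" "B \<le> B2"
    and gm: "\<And>x. x \<in> {0..1} \<Longrightarrow> cub A B x \<in> {0..1}"
    and fm: "\<And>x. x \<in> {0..1} \<Longrightarrow> cub A2 B2 x \<in> {0..1}"
    and per: "nonfixed_periodic_points {0..1} (cub A2 B2) \<noteq> {}"
    and y: "y \<in> nonfixed_periodic_points {0..1} (cub A B)"
  shows "over_rotation_number (cub A B) y
    \<in> over_rotation_number (cub A2 B2) ` nonfixed_periodic_points {0..1} (cub A2 B2)"
proof -
  interpret g: concave_cubic A B a by fact
  interpret f: concave_cubic A2 B2 a2 by fact
  let ?g = "cub A B" and ?f = "cub A2 B2"
  interpret gf: fold_map ?g a g.pre using g.fold_map[OF gm] .
  interpret ff: fold_map ?f a2 f.pre using f.fold_map[OF fm] .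
  obtain n where y01: "y \<in> {0..1}" and n: "(?g ^^ n) y = y" "0 < n" and nf: "?g y \<noteq> y"
    using y by (auto simp: nonfixed_periodic_points_def is_periodic_def)
  show ?thesis
  proof (cases "\<forall>i. (?g ^^ i) y < a \<longrightarrow> a < (?g ^^ Suc i) y")
    case True
    then have "over_rotation_number ?g y = 1/2"
      using gf.over_rotation_half[OF y01 n nf] by blast
    then show ?thesis using ff.half_attained[OF per] by (simp only:)
  next
    case False
    then obtain k where k: "(?g ^^ k) y < a" "(?g ^^ Suc k) y < a"
      using gf.orbit_avoids_fixed[OF n nf gf.f_a] by (metis linorder_neqE)
    obtain i where i: "(?g ^^ i) y < a" "a < ?g ((?g ^^ i) y)"
      using gf.rightmost_left_point[OF y01 n nf] by blast
    define y' where "y' = (?g ^^ i) y"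
    have y': "y' \<in> {0..1}" "(?g ^^ n) y' = y'" "?g y' \<noteq> y'"
      using gf.orbit_01[OF y01] gf.orbit_avoids_fixed[OF n nf, of y' i] n
      by (auto simp: y'_def) (metis comp_apply funpow_add add.commute)
    obtain j where j: "j < n" "(?g ^^ j) y' = (?g ^^ k) y"
      using orbit_wrap[OF n] unfolding y'_def by blast
    have lowj: "(?g ^^ j) y' < a" "(?g ^^ Suc j) y' < a" using k j by simp_all
    have ex0: "y' < a" "a < ?g y'" using i by (simp_all add: y'_def)
    define X where "X = (\<lambda>p. SOME x. p \<le> x \<and> x < a \<and> ?g x = ?g p \<and> dcub A B x \<le> 0)"
    have X: "p \<le> X p \<and> X p < a \<and> ?g (X p) = ?g p \<and> dcub A B (X p) \<le> 0"
      if "0 < p" "p < a" "a < ?g p" for p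
      unfolding X_def by (rule someI_ex) (use g.reflect[OF that] in blast)
    have low_pre: "x \<le> g.pre" if "x < a" "?g x < a" for x
      using g.above_pre[of x] that by force
    obtain m where m: "(?g ^^ m) y' < a" "a < (?g ^^ Suc m) y'"
      "(?g ^^ (m + 2)) y' < a" "(?g ^^ (m + 3)) y' < a"
      using gf.low_after_exit[OF y'(1,2) n(2) y'(3) ex0 lowj] by blast
    define w where "w = (?g ^^ m) y'"
    have "w \<noteq> 0" using gf.orbit_avoids_fixed[OF y'(2) n(2) y'(3) gf.f_0] by (simp add: w_def)
    then have w0: "0 < w" using gf.orbit_01[OF y'(1), of m] by (simp add: w_def)
    have w: "w < a" "a < ?g w" "?g (?g w) < a" "?g (?g (?g w)) < a"
      using m by (simp_all add: w_def numeral_2_eq_2 numeral_3_eq_3)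
    note Xw = X[OF w0 w(1,2)]
    have "g.pre < X w"
      using g.below_pre[of "X w"] g.g_pre Xw w w0 by (cases "X w = g.pre") force+
    then have l: "8/5 \<le> g.steep"
      using g.steep_ge[of "X w"] Xw low_pre[OF w(3,4)] by simp
    have aa: "a \<le> a2"
    proof (rule ccontr)
      assume "\<not> a \<le> a2"
      then have "?f a < a" using f.below_diag[of a] g.a_less by simp
      moreover have "?f a = ?g a + cub (A2 - A) (B2 - B) a" using cub_add[of A "A2 - A" B "B2 - B" a] by simp
      moreover have "0 \<le> cub (A2 - A) (B2 - B) a" using le g.a_pos g.a_less by (intro cub_nonneg) auto
      ultimately show False using g.fix_a by simp
    qed
    have ge: "?g x \<le> ?f x" if "x \<in> {0..1}" for x
      using cub_add[of A "A2 - A" B "B2 - B" x] cub_nonneg[of "A2 - A" "B2 - B" x] le that by simp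
    have comp: "(?f ^^ k) (?f (?f (X p))) \<le> (?g ^^ k) (?g (?g p))"
      if p: "0 < p" "p < a" "a < ?g p" and
        low: "\<And>j. j < k \<Longrightarrow> (?g ^^ j) (?g (?g p)) < a \<and> (?g ^^ Suc j) (?g (?g p)) < a" for p k
    proof -
      note Xp = X[OF p]
      have "(cub (A + (A2 - A)) (B + (B2 - B)) ^^ k) (cub (A + (A2 - A)) (B + (B2 - B)) (cub (A + (A2 - A)) (B + (B2 - B)) (X p)))
          \<le> (?g ^^ k) (?g (?g (X p)))"
      proof (rule g.orbit_comparison)
        fix j assume "j < k"
        then show "(?g ^^ j) (?g (?g (X p))) \<le> g.pre"
          using low[of j] low_pre Xp by simp
      qed (use le l Xp p fm in auto)
      then show ?thesis using Xp by simp
    qed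
    obtain x where x: "x \<in> {0..1}" "(?f ^^ n) x = x" "?f x \<noteq> x"
      and same: "\<And>i. i < n \<Longrightarrow> a2 < (?f ^^ i) x \<longleftrightarrow> a < (?g ^^ i) y'"
      using transfer_orbit[OF ff.fold_map_axioms gf.fold_map_axioms aa ge y' ex0 j(1) lowj, of X]
        X comp by blast
    have "over_rotation_number ?f x = over_rotation_number ?g y'"
      unfolding ff.over_rotation_number_eq[OF x(1,2) n(2) x(3)]
        gf.over_rotation_number_eq[OF y'(1,2) n(2) y'(3)] using same by simp
    also have "\<dots> = over_rotation_number ?g y"
      unfolding y'_def by (rule gf.over_rotation_number_orbit[OF y01 n nf])
    finally have "over_rotation_number ?g y = over_rotation_number ?f x" by simp
    moreover have "x \<in> nonfixed_periodic_points {0..1} ?f"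
      using x n by (auto simp: nonfixed_periodic_points_def is_periodic_def)
    ultimately show ?thesis by blast
  qed
qed

theorem lemma3p7:
  fixes f g :: "real \<Rightarrow> real"
  assumes "f \<in> class_G" and "g \<in> class_G"
    and "nonfixed_periodic_points {0..1} f \<noteq> {}"
    and "nonfixed_periodic_points {0..1} g \<noteq> {}"
    and "\<forall>x\<in>{0..1}. f x \<ge> g x"
  shows "over_rotation_interval {0..1} f \<supseteq> over_rotation_interval {0..1} g"
proof -
  obtain A B a where g: "concave_cubic A B a" "\<And>x. x \<in> {0..1} \<Longrightarrow> g x = cub A B x"
    "\<And>x. x \<in> {0..1} \<Longrightarrow> cub A B x \<in> {0..1}" by (rule class_G_cub[OF assms(2)]) blast
  obtain A2 B2 a2 where f: "concave_cubic A2 B2 a2" "\<And>x. x \<in> {0..1} \<Longrightarrow> f x = cub A2 B2 x"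
    "\<And>x. x \<in> {0..1} \<Longrightarrow> cub A2 B2 x \<in> {0..1}" by (rule class_G_cub[OF assms(1)]) blast
  have le: "A \<le> A2" "B \<le> B2"
    using assms(5) g(2) f(2) by (auto intro!: coeffs_le_if_cub_le[of A B A2 B2])
  have fc: "nonfixed_periodic_points {0..1} f = nonfixed_periodic_points {0..1} (cub A2 B2)"
    "over_rotation_interval {0..1} f = over_rotation_interval {0..1} (cub A2 B2)"
    using f(2,3) by (intro over_rotation_interval_cong; simp)+
  have gc: "over_rotation_interval {0..1} g = over_rotation_interval {0..1} (cub A B)"
    using g(2,3) by (intro over_rotation_interval_cong; simp)
  have "over_rotation_number (cub A B) ` nonfixed_periodic_points {0..1} (cub A B)
      \<subseteq> over_rotation_number (cub A2 B2) ` nonfixed_periodic_points {0..1} (cub A2 B2)"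
    using cubic_over_rotation_subset[OF g(1) f(1) le g(3) f(3)] assms(3) fc(1) by auto
  then show ?thesis
    unfolding fc(2) gc by (simp add: over_rotation_interval_def closure_mono)
qed

end
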